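(* Let $L_1,\dots,L_M\in\mathbb{N}$ and $q_1,\dots,q_M\in\mathbb{R}[x]$ with $\deg q_j<2L_j$, $q_j(0)=0$, and let $P(x,y)=\prod_{j=1}^M(y+q_j(x)+ix^{2L_j})$, $A=\tfrac12(P+\bar P)$, $B=\tfrac1{2i}(P-\bar P)$. Let $t\in\mathbb{R}$ be proper and write $a_j(x;t)=-q_j(x)-x^{2L_j}\psi_j(x;t)$ for the branches from the proper factorization. Let $1\le\mathfrak{p}<\infty$. Then for $Q\in\mathbb{C}\{x,y\}$, $Q/P\in L^{\mathfrak{p}}_{loc}$ if and only if for each $j=1,\dots,M$, $$\mathrm{Ord}\bigl(Q(x,a_j(x;t))\bigr)\ge\sum_{i=1}^MO_{ij}-\left\lceil\frac{2L_j+1}{\mathfrak{p}}\right\rceil+1.$$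
   Context: $\bar P(x,y)=\overline{P(\bar x,\bar y)}$. $\mathbb{C}\{x,y\}$ are convergent power series at the origin, $\mathbb{R}\{x\}$ convergent real-coefficient series in $x$; a unit is a series nonvanishing at the origin; Ord is order of vanishing at $0$. $f\in L^{\mathfrak{p}}_{loc}$ means $f\in L^{\mathfrak{p}}(U)$ for some neighborhood $U$ of $(0,0)$ in $\mathbb{R}^2$. $O_{ij}=\min\{\mathrm{Ord}(q_j-q_i),2L_j,2L_i\}$. A real $t$ is called proper if there is a local factorization $A+tB=u(x,y;t)\prod_{j=1}^M(y+q_j(x)+x^{2L_j}\psi_j(x;t))$ with $u(\cdot,\cdot;t)$ a unit, $\psi_j(\cdot;t)\in\mathbb{R}\{x\}$, and $\mathrm{Ord}(q_j-q_i+x^{2L_j}\psi_j(x;t)-x^{2L_i}\psi_i(x;t))=O_{ij}$ for all $i\ne j$; all but finitely many real $t$ are proper. *)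

theory Defs
  imports "HOL-Analysis.Analysis" "HOL-Computational_Algebra.Polynomial"
begin

definition conv_ps1 :: "(nat \<Rightarrow> real) \<Rightarrow> bool" where
  "conv_ps1 c \<longleftrightarrow> (\<exists>r>0. summable (\<lambda>n. \<bar>c n\<bar> * r ^ n))"

definition eval_ps1 :: "(nat \<Rightarrow> real) \<Rightarrow> real \<Rightarrow> real" where
  "eval_ps1 c x = (\<Sum>n. c n * x ^ n)"

definition conv_ps2 :: "(nat \<Rightarrow> nat \<Rightarrow> complex) \<Rightarrow> bool" where
  "conv_ps2 c \<longleftrightarrow> (\<exists>r>0. (\<lambda>(i,j). norm (c i j) * r ^ (i + j)) summable_on UNIV)"

definition eval_ps2 :: "(nat \<Rightarrow> nat \<Rightarrow> complex) \<Rightarrow> complex \<Rightarrow> complex \<Rightarrow> complex" where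
  "eval_ps2 c x y = (\<Sum>\<^sub>\<infinity>(i,j). c i j * x ^ i * y ^ j)"

definition is_unit_ps2 :: "(nat \<Rightarrow> nat \<Rightarrow> complex) \<Rightarrow> bool" where
  "is_unit_ps2 c \<longleftrightarrow> conv_ps2 c \<and> c 0 0 \<noteq> 0"

definition vanishes_to_order :: "(real \<Rightarrow> 'a::real_normed_vector) \<Rightarrow> nat \<Rightarrow> bool" where
  "vanishes_to_order f k \<longleftrightarrow>
     (\<exists>C>0. \<exists>\<delta>>0. \<forall>x. \<bar>x\<bar> < \<delta> \<longrightarrow> norm (f x) \<le> C * \<bar>x\<bar> ^ k)"

text \<open>Ord f: order of vanishing of f at 0 (infinity if f vanishes identically near 0).\<close>
definition Ord :: "(real \<Rightarrow> 'a::real_normed_vector) \<Rightarrow> enat" where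
  "Ord f = Sup {enat k | k. vanishes_to_order f k}"

definition Pfun :: "nat \<Rightarrow> (nat \<Rightarrow> real poly) \<Rightarrow> (nat \<Rightarrow> nat) \<Rightarrow> complex \<Rightarrow> complex \<Rightarrow> complex" where
  "Pfun M q L x y = (\<Prod>j<M. y + poly (map_poly complex_of_real (q j)) x + \<i> * x ^ (2 * L j))"

definition Pbar :: "nat \<Rightarrow> (nat \<Rightarrow> real poly) \<Rightarrow> (nat \<Rightarrow> nat) \<Rightarrow> complex \<Rightarrow> complex \<Rightarrow> complex" where
  "Pbar M q L x y = cnj (Pfun M q L (cnj x) (cnj y))"

definition Afun :: "nat \<Rightarrow> (nat \<Rightarrow> real poly) \<Rightarrow> (nat \<Rightarrow> nat) \<Rightarrow> complex \<Rightarrow> complex \<Rightarrow> complex" where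
  "Afun M q L x y = (Pfun M q L x y + Pbar M q L x y) / 2"

definition Bfun :: "nat \<Rightarrow> (nat \<Rightarrow> real poly) \<Rightarrow> (nat \<Rightarrow> nat) \<Rightarrow> complex \<Rightarrow> complex \<Rightarrow> complex" where
  "Bfun M q L x y = (Pfun M q L x y - Pbar M q L x y) / (2 * \<i>)"

definition Oij :: "(nat \<Rightarrow> real poly) \<Rightarrow> (nat \<Rightarrow> nat) \<Rightarrow> nat \<Rightarrow> nat \<Rightarrow> enat" where
  "Oij q L i j = min (Ord (\<lambda>x. poly (q j - q i) x)) (min (enat (2 * L j)) (enat (2 * L i)))"

text \<open>t is proper, witnessed by the unit u (coefficients cu) and the series psi_j:
  locally A + tB = u * prod_j (y + q_j(x) + x^(2L_j) psi_j(x;t)), with the order condition.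
  The identity of convergent series is expressed as equality of their sums on a
  real neighbourhood of the origin.\<close>
definition proper_factorization ::
  "nat \<Rightarrow> (nat \<Rightarrow> real poly) \<Rightarrow> (nat \<Rightarrow> nat) \<Rightarrow> real \<Rightarrow>
   (nat \<Rightarrow> nat \<Rightarrow> complex) \<Rightarrow> (nat \<Rightarrow> nat \<Rightarrow> real) \<Rightarrow> bool" where
  "proper_factorization M q L t cu psi \<longleftrightarrow>
     is_unit_ps2 cu \<and> (\<forall>j<M. conv_ps1 (psi j)) \<and>
     (\<forall>\<^sub>F z in nhds (0::real, 0::real).
        Afun M q L (of_real (fst z)) (of_real (snd z))
          + of_real t * Bfun M q L (of_real (fst z)) (of_real (snd z))
        = eval_ps2 cu (of_real (fst z)) (of_real (snd z)) *
          (\<Prod>j<M. of_real (snd z + poly (q j) (fst z)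
                           + fst z ^ (2 * L j) * eval_ps1 (psi j) (fst z)))) \<and>
     (\<forall>i<M. \<forall>j<M. i \<noteq> j \<longrightarrow>
        Ord (\<lambda>x. poly (q j - q i) x + x ^ (2 * L j) * eval_ps1 (psi j) x
                  - x ^ (2 * L i) * eval_ps1 (psi i) x) = Oij q L i j)"

definition proper :: "nat \<Rightarrow> (nat \<Rightarrow> real poly) \<Rightarrow> (nat \<Rightarrow> nat) \<Rightarrow> real \<Rightarrow> bool" where
  "proper M q L t \<longleftrightarrow> (\<exists>cu psi. proper_factorization M q L t cu psi)"

definition branch :: "(nat \<Rightarrow> real poly) \<Rightarrow> (nat \<Rightarrow> nat) \<Rightarrow> (nat \<Rightarrow> nat \<Rightarrow> real) \<Rightarrow> nat \<Rightarrow> real \<Rightarrow> real" where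
  "branch q L psi j x = - poly (q j) x - x ^ (2 * L j) * eval_ps1 (psi j) x"

definition Lp_loc :: "real \<Rightarrow> (real \<times> real \<Rightarrow> complex) \<Rightarrow> bool" where
  "Lp_loc p f \<longleftrightarrow> (\<exists>U. open U \<and> (0, 0) \<in> U \<and> set_borel_measurable lborel U f \<and>
      (\<integral>\<^sup>+ z \<in> U. ennreal (norm (f z) powr p) \<partial>lborel) < \<infinity>)"

end

theory Submission
  imports Defs
begin

text \<open>Near the origin \<open>|P|\<close> is comparable to \<open>\<Prod>\<^sub>j (|y - a\<^sub>j(x)| + |x|\<^bsup>2L\<^sub>j\<^esup>)\<close>, and
  \<open>|a\<^sub>i - a\<^sub>j|\<close> is comparable to \<open>|x|\<^bsup>O\<^sub>i\<^sub>j\<^esup>\<close>.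

  If the order conditions hold, Lagrange interpolation of \<open>Q(x, \<cdot>)\<close> at the nodes \<open>a\<^sub>j(x)\<close> has a
  remainder bounded by a multiple of \<open>\<Prod>\<^sub>j |y - a\<^sub>j|\<close>, so \<open>Q/P\<close> is dominated by a constant plus terms
  \<open>|Q(x, a\<^sub>j)| |x|\<^bsup>-s\<^esup> / (|y - a\<^sub>j| + |x|\<^bsup>2L\<^sub>j\<^esup>)\<close>, where \<open>s\<close> is the sum of the \<open>O\<^sub>i\<^sub>j\<close> with
  \<open>i \<noteq> j\<close>. The order condition puts each of these terms in \<open>L\<^sup>p\<close>.

  Conversely, if \<open>Q(x, a\<^sub>j)\<close> has exact order \<open>k\<close>, interpolation at \<open>a\<^sub>j + h, \<dots>, a\<^sub>j + (k+1) h\<close> with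
  \<open>h = \<theta> x\<^bsup>2L\<^sub>j\<^esup>\<close> shows that \<open>|Q|\<close> is at least a multiple of \<open>|x|\<^bsup>k\<^esup>\<close> at one of the nodes; integrating over
  \<open>\<theta>\<close> and \<open>x\<close> gives a divergent integral as soon as \<open>k\<close> is below the stated bound.\<close>

subsection \<open>Lagrange interpolation of power series\<close>

text \<open>The weighted l^1 norm of the coefficients. It bounds the polynomial on the disc of
  radius \<open>R\<close> and is controlled under division by a linear factor through Horner's
  recursion alone, without Cauchy estimates.\<close>

definition majorant :: "complex poly \<Rightarrow> real \<Rightarrow> real" where
  "majorant p R = poly (map_poly norm p) R"

lemma majorant_0 [simp]: "majorant 0 R = 0"
  by (simp add: majorant_def)

lemma majorant_pCons: "majorant (pCons c p) R = norm c + R * majorant p R"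
  by (simp add: majorant_def map_poly_pCons)

lemma majorant_nonneg: "0 \<le> R \<Longrightarrow> 0 \<le> majorant p R"
  by (induction p) (auto simp: majorant_pCons)

lemma majorant_monom: "majorant (monom 1 n) R = R ^ n"
  by (simp add: majorant_def map_poly_monom poly_monom)

lemma norm_poly_le_majorant:
  assumes "norm y \<le> R"
  shows "norm (poly p y) \<le> majorant p R"
proof (induction p)
  case (pCons c p)
  have "norm (poly (pCons c p) y) \<le> norm c + norm y * norm (poly p y)"
    by (metis norm_mult norm_triangle_ineq poly_pCons)
  also have "\<dots> \<le> norm c + R * majorant p R"
    using pCons assms by (intro add_mono mult_mono) (auto intro: order_trans[OF norm_ge_zero])
  finally show ?case by (simp add: majorant_pCons)
qed simp

text \<open>For a monomial this is the factorization of R^n - \<rho>^n by R - \<rho>. The subtracted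
  majorant at \<open>\<rho>\<close> is what lets the induction close: the new coefficient of the
  quotient is \<open>poly p a\<close>, of size at most \<open>majorant p \<rho>\<close>.\<close>

lemma majorant_synthetic_div:
  assumes "norm a \<le> \<rho>" "\<rho> < R"
  shows "majorant (synthetic_div p a) R * (R - \<rho>) \<le> majorant p R - majorant p \<rho>"
proof (induction p)
  case (pCons c p)
  have R: "0 \<le> R" using assms norm_ge_zero[of a] by linarith
  have "majorant (synthetic_div (pCons c p) a) R * (R - \<rho>)
      = norm (poly p a) * (R - \<rho>) + R * (majorant (synthetic_div p a) R * (R - \<rho>))"
    by (simp add: majorant_pCons algebra_simps)
  also have "\<dots> \<le> majorant p \<rho> * (R - \<rho>) + R * (majorant p R - majorant p \<rho>)"
    using assms norm_poly_le_majorant[OF assms(1)] pCons R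
    by (intro add_mono mult_right_mono mult_left_mono) auto
  also have "\<dots> = majorant (pCons c p) R - majorant (pCons c p) \<rho>"
    by (simp add: majorant_pCons algebra_simps)
  finally show ?case .
qed simp

definition lagrange :: "'i set \<Rightarrow> ('i \<Rightarrow> complex) \<Rightarrow> 'i \<Rightarrow> complex \<Rightarrow> complex" where
  "lagrange S a j y = (\<Prod>i\<in>S - {j}. (y - a i) / (a j - a i))"

text \<open>Nodes are added one at a time. The cofactor \<open>G\<close> of the nodal product is
  divided by the new linear factor, which costs one factor \<open>R - \<rho>\<close>; the constant
  left over is absorbed by the basis polynomial of the new node.\<close>

lemma lagrange_interpolation_poly:
  assumes "finite S" "inj_on a S" "\<forall>i\<in>S. norm (a i) \<le> \<rho>" "\<rho> < R" "0 \<le> R"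
  shows "\<exists>G. majorant G R * (R - \<rho>) ^ card S \<le> majorant f R \<and>
    (\<forall>y. poly f y = (\<Sum>j\<in>S. poly f (a j) * lagrange S a j y) + poly G y * (\<Prod>i\<in>S. y - a i))"
  using assms
proof (induction S rule: finite_induct)
  case empty
  show ?case by (intro exI[of _ f]) auto
next
  case (insert b S)
  then obtain G where G: "majorant G R * (R - \<rho>) ^ card S \<le> majorant f R"
    "\<And>y. poly f y = (\<Sum>j\<in>S. poly f (a j) * lagrange S a j y) + poly G y * (\<Prod>i\<in>S. y - a i)"
    by auto
  define H where "H = synthetic_div G (a b)"
  have GH: "poly G y = (y - a b) * poly H y + poly G (a b)" for y
  proof -
    have "poly ([:-a b, 1:] * H + [:poly G (a b):]) y = poly G y"
      unfolding H_def synthetic_div_correct' ..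
    thus ?thesis by (simp add: algebra_simps)
  qed
  have nz: "a b - a i \<noteq> 0" "a i - a b \<noteq> 0" if "i \<in> S" for i
    using insert that by (auto simp: inj_on_def)
  have bound: "majorant H R * (R - \<rho>) ^ card (insert b S) \<le> majorant f R"
  proof -
    have "majorant H R * (R - \<rho>) \<le> majorant G R"
      using majorant_synthetic_div[of "a b" \<rho> R G] insert.prems majorant_nonneg[of \<rho> G]
      by (force simp: H_def intro: order_trans[OF norm_ge_zero])
    hence "majorant H R * (R - \<rho>) * (R - \<rho>) ^ card S \<le> majorant G R * (R - \<rho>) ^ card S"
      using insert.prems by (intro mult_right_mono) auto
    thus ?thesis using G insert.hyps by (simp add: mult_ac)
  qed
  have ident: "poly f y = (\<Sum>j\<in>insert b S. poly f (a j) * lagrange (insert b S) a j y)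
      + poly H y * (\<Prod>i\<in>insert b S. y - a i)" for y
  proof -
    define l where "l = lagrange S a"
    have lb: "lagrange (insert b S) a b z = (\<Prod>i\<in>S. z - a i) / (\<Prod>i\<in>S. a b - a i)" for z
      using insert.hyps by (simp add: lagrange_def prod_dividef)
    have nzp: "(\<Prod>i\<in>S. a b - a i) \<noteq> 0" using nz insert.hyps by simp
    \<comment> \<open>Each old basis polynomial is made to vanish at the new node by subtracting a
      multiple of the new basis polynomial.\<close>
    have lj: "lagrange (insert b S) a j y = l j y - l j (a b) * lagrange (insert b S) a b y"
      if j: "j \<in> S" for j
    proof -
      have "insert b S - {j} = insert b (S - {j})" using j insert.hyps by auto
      hence 1: "lagrange (insert b S) a j y = (y - a b) / (a j - a b) * l j y"
        using insert.hyps j by (simp add: lagrange_def l_def)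
      define p where "p = (\<Prod>i\<in>S - {j}. y - a i)"
      define r where "r = (\<Prod>i\<in>S - {j}. a b - a i)"
      define s where "s = (\<Prod>i\<in>S - {j}. a j - a i)"
      have 2: "lagrange (insert b S) a b y = (y - a j) * p / ((a b - a j) * r)"
        unfolding lb p_def r_def using insert.hyps j by (simp add: prod.remove)
      have 3: "l j y = p / s" "l j (a b) = r / s"
        by (simp_all add: l_def lagrange_def p_def r_def s_def prod_dividef)
      have rs: "r \<noteq> 0" "s \<noteq> 0"
        using insert j nz by (auto simp: r_def s_def inj_on_def)
      show ?thesis
        unfolding 1 2 3 using rs nz[OF j] by (simp add: divide_simps) (simp add: algebra_simps)
    qed
    \<comment> \<open>The old identity at the new node \<open>a b\<close> determines the division
      constant.\<close>
    have Gb: "poly G (a b) * (\<Prod>i\<in>S. y - a i)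
        = (poly f (a b) - (\<Sum>j\<in>S. poly f (a j) * l j (a b))) * lagrange (insert b S) a b y"
      using G(2)[of "a b"] nzp unfolding lb l_def by (simp add: divide_simps)
    have "(\<Sum>j\<in>insert b S. poly f (a j) * lagrange (insert b S) a j y)
        = poly f (a b) * lagrange (insert b S) a b y
          + (\<Sum>j\<in>S. poly f (a j) * (l j y - l j (a b) * lagrange (insert b S) a b y))"
      using insert.hyps lj by (simp add: sum.insert)
    also have "\<dots> = (\<Sum>j\<in>S. poly f (a j) * l j y) + poly G (a b) * (\<Prod>i\<in>S. y - a i)"
      unfolding Gb by (simp add: algebra_simps sum_subtractf sum_distrib_left sum_distrib_right)
    finally show ?thesis
      using G(2)[of y] GH[of y] insert.hyps by (simp add: l_def algebra_simps)
  qed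
  show ?case using bound ident by blast
qed

text \<open>The majorant of a monomial is \<open>R ^ n\<close>, exactly the weight of the n-th term
  in an absolutely convergent series, so these bounds can be summed termwise.\<close>

lemma lagrange_remainder_power:
  assumes "finite S" "inj_on a S" "\<forall>i\<in>S. norm (a i) \<le> \<rho>" "\<rho> < R" "norm y \<le> R"
  shows "norm (y ^ n - (\<Sum>j\<in>S. a j ^ n * lagrange S a j y))
    \<le> R ^ n / (R - \<rho>) ^ card S * norm (\<Prod>i\<in>S. y - a i)"
proof -
  have R: "0 \<le> R" using assms(5) norm_ge_zero order_trans by blast
  obtain G where G: "majorant G R * (R - \<rho>) ^ card S \<le> R ^ n"
    "\<And>y. y ^ n = (\<Sum>j\<in>S. a j ^ n * lagrange S a j y) + poly G y * (\<Prod>i\<in>S. y - a i)"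
    using lagrange_interpolation_poly[OF assms(1-4) R, of "monom 1 n"]
    by (auto simp: poly_monom majorant_monom)
  have "norm (poly G y) \<le> R ^ n / (R - \<rho>) ^ card S"
    using norm_poly_le_majorant[OF assms(5), of G] G(1) assms(4)
    by (simp add: pos_le_divide_eq) (meson diff_gt_0_iff_gt less_eq_real_def mult_right_mono order_trans zero_le_power)
  from mult_right_mono[OF this norm_ge_zero, of "\<Prod>i\<in>S. y - a i"] show ?thesis
    using G(2)[of y] by (simp add: norm_mult)
qed

section \<open>Interpolation remainder for convergent double power series\<close>

lemma conv_ps2_radius:
  assumes "conv_ps2 c"
  obtains r where "0 < r" "(\<lambda>(i,j). norm (c i j) * r ^ (i + j)) summable_on UNIV"
  using assms by (auto simp: conv_ps2_def)

lemma ps2_term_le: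
  fixes x y :: complex
  assumes "norm x \<le> r" "norm y \<le> r"
  shows "norm (c i j * x ^ i * y ^ j) \<le> norm (c i j) * r ^ (i + j)"
proof -
  have "0 \<le> r" using assms norm_ge_zero order_trans by blast
  thus ?thesis
    unfolding norm_mult norm_power power_add mult.assoc
    using assms by (intro mult_left_mono mult_mono power_mono) auto
qed

lemma ps2_abs_summable:
  fixes x y :: complex
  assumes "(\<lambda>(i,j). norm (c i j) * r ^ (i + j)) summable_on UNIV" "norm x \<le> r" "norm y \<le> r"
  shows "(\<lambda>k. norm (case k of (i,j) \<Rightarrow> c i j * x ^ i * y ^ j)) summable_on A"
  by (rule summable_on_subset_banach[OF Infinite_Sum.summable_on_comparison_test[OF assms(1)]])
     (auto simp: ps2_term_le[OF assms(2,3)])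

lemma ps2_summable:
  fixes x y :: complex
  assumes "(\<lambda>(i,j). norm (c i j) * r ^ (i + j)) summable_on UNIV" "norm x \<le> r" "norm y \<le> r"
  shows "(\<lambda>(i,j). c i j * x ^ i * y ^ j) summable_on A"
  using ps2_abs_summable[OF assms] by (rule abs_summable_summable)

lemma norm_infsum_le_infsum:
  fixes f :: "'a \<Rightarrow> complex" and g :: "'a \<Rightarrow> real"
  assumes "g summable_on A" "\<And>x. x \<in> A \<Longrightarrow> norm (f x) \<le> g x"
  shows "norm (infsum f A) \<le> infsum g A"
proof -
  have "(\<lambda>x. norm (f x)) summable_on A"
    using assms by (rule summable_on_comparison_test) auto
  hence "norm (infsum f A) \<le> (\<Sum>\<^sub>\<infinity>x\<in>A. norm (f x))"
    by (rule norm_infsum_bound)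
  also have "\<dots> \<le> infsum g A"
    using \<open>(\<lambda>x. norm (f x)) summable_on A\<close> assms by (intro infsum_mono)
  finally show ?thesis .
qed

lemma has_sum_finite_sum:
  fixes f :: "'i \<Rightarrow> 'a \<Rightarrow> complex"
  assumes "finite S" "\<And>j. j \<in> S \<Longrightarrow> (f j has_sum s j) A"
  shows "((\<lambda>x. \<Sum>j\<in>S. f j x) has_sum (\<Sum>j\<in>S. s j)) A"
  using assms by (induction S rule: finite_induct) (auto intro: has_sum_add)

text \<open>The monomial bound is applied to every term and summed. The nodes enter the constant
  only through \<open>\<rho>\<close> and their number, so the estimate stays uniform when the nodes
  merge, as the branches do when x tends to 0.\<close>

lemma lagrange_remainder_ps2:
  fixes x y :: complex
  assumes r: "(\<lambda>(i,j). norm (c i j) * r ^ (i + j)) summable_on UNIV"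
    and S: "finite S" "inj_on a S" "\<forall>i\<in>S. norm (a i) \<le> \<rho>" "\<rho> < r"
    and xy: "norm x \<le> r" "norm y \<le> r"
  shows "norm (eval_ps2 c x y - (\<Sum>j\<in>S. eval_ps2 c x (a j) * lagrange S a j y))
    \<le> (\<Sum>\<^sub>\<infinity>(i,j). norm (c i j) * r ^ (i + j)) / (r - \<rho>) ^ card S * norm (\<Prod>i\<in>S. y - a i)"
proof -
  define D where "D = norm (\<Prod>i\<in>S. y - a i) / (r - \<rho>) ^ card S"
  define T where "T = (\<lambda>y (i,j). c i j * x ^ i * y ^ j)"
  have hs: "(T z has_sum eval_ps2 c x z) UNIV" if "norm z \<le> r" for z
    unfolding eval_ps2_def T_def
    using ps2_summable[OF r xy(1) that] by (rule has_sum_infsum)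
  have "((\<lambda>k. \<Sum>j\<in>S. T (a j) k * lagrange S a j y) has_sum
      (\<Sum>j\<in>S. eval_ps2 c x (a j) * lagrange S a j y)) UNIV"
    using S xy by (intro has_sum_finite_sum has_sum_cmult_left hs) fastforce+
  hence "((\<lambda>k. T y k + - (\<Sum>j\<in>S. T (a j) k * lagrange S a j y)) has_sum
      (eval_ps2 c x y + - (\<Sum>j\<in>S. eval_ps2 c x (a j) * lagrange S a j y))) UNIV"
    using xy by (intro has_sum_add hs) (simp_all add: has_sum_uminus)
  hence eq: "eval_ps2 c x y - (\<Sum>j\<in>S. eval_ps2 c x (a j) * lagrange S a j y)
      = (\<Sum>\<^sub>\<infinity>k. T y k - (\<Sum>j\<in>S. T (a j) k * lagrange S a j y))"
    by (simp add: infsumI)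
  have "norm (T y k - (\<Sum>j\<in>S. T (a j) k * lagrange S a j y))
      \<le> (case k of (i,n) \<Rightarrow> norm (c i n) * r ^ (i + n)) * D" for k
  proof -
    obtain i n where k: "k = (i,n)" by force
    have "norm (T y k - (\<Sum>j\<in>S. T (a j) k * lagrange S a j y))
        = norm (c i n) * norm x ^ i * norm (y ^ n - (\<Sum>j\<in>S. a j ^ n * lagrange S a j y))"
      by (simp add: k T_def sum_distrib_left right_diff_distrib mult.assoc flip: norm_mult norm_power)
    also have "\<dots> \<le> norm (c i n) * r ^ i * (r ^ n / (r - \<rho>) ^ card S * norm (\<Prod>i\<in>S. y - a i))"
      using S xy by (intro mult_mono lagrange_remainder_power power_mono)
        (auto intro!: mult_nonneg_nonneg zero_le_power intro: order_trans[OF norm_ge_zero])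
    finally show ?thesis by (simp add: k D_def power_add mult_ac)
  qed
  moreover have "(\<lambda>k. (case k of (i,n) \<Rightarrow> norm (c i n) * r ^ (i + n)) * D) summable_on UNIV"
    using r by (rule summable_on_cmult_left)
  ultimately have "norm (eval_ps2 c x y - (\<Sum>j\<in>S. eval_ps2 c x (a j) * lagrange S a j y))
      \<le> (\<Sum>\<^sub>\<infinity>k. (case k of (i,n) \<Rightarrow> norm (c i n) * r ^ (i + n)) * D)"
    unfolding eq by (intro norm_infsum_le_infsum) auto
  also have "\<dots> = (\<Sum>\<^sub>\<infinity>(i,j). norm (c i j) * r ^ (i + j)) * D"
    by (rule infsum_cmult_left) (use r in auto)
  finally show ?thesis by (simp add: D_def)
qed

subsection \<open>Orders of vanishing and Taylor expansions\<close>

lemma vanishes_to_order_iff_eventually: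
  "vanishes_to_order f k \<longleftrightarrow> (\<exists>C. \<forall>\<^sub>F x in nhds 0. norm (f x) \<le> C * \<bar>x\<bar> ^ k)"
proof
  assume "vanishes_to_order f k"
  thus "\<exists>C. \<forall>\<^sub>F x in nhds 0. norm (f x) \<le> C * \<bar>x\<bar> ^ k"
    by (auto simp: vanishes_to_order_def eventually_nhds_metric dist_real_def)
next
  assume "\<exists>C. \<forall>\<^sub>F x in nhds 0. norm (f x) \<le> C * \<bar>x\<bar> ^ k"
  then obtain C d where "d > 0" and C: "\<And>x. \<bar>x\<bar> < d \<Longrightarrow> norm (f x) \<le> C * \<bar>x\<bar> ^ k"
    by (auto simp: eventually_nhds_metric dist_real_def)
  moreover have "C * \<bar>x\<bar> ^ k \<le> max C 1 * \<bar>x\<bar> ^ k" for x :: real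
    by (intro mult_right_mono) auto
  ultimately show "vanishes_to_order f k"
    unfolding vanishes_to_order_def
    by (intro exI[of _ "max C 1"] conjI exI[of _ d]) (auto intro: order_trans)
qed

lemma eventually_nhds_0_abs_less: "e > 0 \<Longrightarrow> \<forall>\<^sub>F x in nhds 0. \<bar>x::real\<bar> < e"
  by (auto simp: eventually_nhds_metric dist_real_def)

lemma vanishes_to_order_mono:
  assumes "vanishes_to_order f k" "l \<le> k"
  shows "vanishes_to_order f l"
proof -
  obtain C d where C: "C > 0" "d > 0" "\<And>x. \<bar>x\<bar> < d \<Longrightarrow> norm (f x) \<le> C * \<bar>x\<bar> ^ k"
    using assms by (auto simp: vanishes_to_order_def)
  have "norm (f x) \<le> C * \<bar>x\<bar> ^ l" if "\<bar>x\<bar> < min d 1" for x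
    using C(3)[of x] that C(1) power_decreasing[OF assms(2), of "\<bar>x\<bar>"]
    by (smt (verit) mult_left_mono min_less_iff_conj abs_ge_zero)
  thus ?thesis unfolding vanishes_to_order_def
    using C by (intro exI[of _ C] conjI exI[of _ "min d 1"]) auto
qed

lemma vanishes_to_order_add:
  assumes "vanishes_to_order f k" "vanishes_to_order g k"
  shows "vanishes_to_order (\<lambda>x. f x + g x) k"
proof -
  obtain C D where "\<forall>\<^sub>F x in nhds 0. norm (f x) \<le> C * \<bar>x\<bar> ^ k" "\<forall>\<^sub>F x in nhds 0. norm (g x) \<le> D * \<bar>x\<bar> ^ k"
    using assms by (auto simp: vanishes_to_order_iff_eventually)
  hence "\<forall>\<^sub>F x in nhds 0. norm (f x + g x) \<le> (C + D) * \<bar>x\<bar> ^ k"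
    by eventually_elim (auto simp: algebra_simps intro: norm_triangle_le)
  thus ?thesis by (auto simp: vanishes_to_order_iff_eventually)
qed

lemma vanishes_to_order_mult:
  fixes f g :: "real \<Rightarrow> 'a :: real_normed_div_algebra"
  assumes "vanishes_to_order f k" "vanishes_to_order g l"
  shows "vanishes_to_order (\<lambda>x. f x * g x) (k + l)"
proof -
  obtain C D where "C > 0" and CD: "\<forall>\<^sub>F x in nhds 0. norm (f x) \<le> C * \<bar>x\<bar> ^ k" "\<forall>\<^sub>F x in nhds 0. norm (g x) \<le> D * \<bar>x\<bar> ^ l"
    using assms(1) assms(2)[unfolded vanishes_to_order_iff_eventually]
    by (auto simp: vanishes_to_order_def eventually_nhds_metric dist_real_def)
  from CD have "\<forall>\<^sub>F x in nhds 0. norm (f x * g x) \<le> (C * D) * \<bar>x\<bar> ^ (k + l)"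
  proof eventually_elim
    case (elim x)
    have "norm (f x) * norm (g x) \<le> (C * \<bar>x\<bar> ^ k) * (D * \<bar>x\<bar> ^ l)"
      using elim \<open>C > 0\<close> by (intro mult_mono) auto
    thus ?case by (simp add: norm_mult power_add mult_ac)
  qed
  thus ?thesis by (auto simp: vanishes_to_order_iff_eventually)
qed

lemma vanishes_to_order_uminus: "vanishes_to_order (\<lambda>x. - f x) k \<longleftrightarrow> vanishes_to_order f k"
  by (simp add: vanishes_to_order_def)

lemma vanishes_to_order_diff:
  assumes "vanishes_to_order f k" "vanishes_to_order g k"
  shows "vanishes_to_order (\<lambda>x. f x - g x) k"
  using vanishes_to_order_add[OF assms(1), of "\<lambda>x. - g x"] assms(2)
  by (simp add: vanishes_to_order_uminus)

lemma vanishes_to_order_power_id: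
  "vanishes_to_order (\<lambda>x. of_real x ^ k :: 'a :: real_normed_div_algebra) k"
  unfolding vanishes_to_order_iff_eventually
  by (rule exI[of _ 1]) (simp add: norm_power)

lemma vanishes_to_order_zero [simp]: "vanishes_to_order (\<lambda>x. 0) k"
  unfolding vanishes_to_order_iff_eventually by (rule exI[of _ 0]) simp

lemma isCont_vanishes_to_order_0:
  assumes "isCont f (0::real)"
  shows "vanishes_to_order f 0"
proof -
  have "((\<lambda>x. norm (f x)) \<longlongrightarrow> norm (f 0)) (nhds 0)"
    using assms by (intro tendsto_norm) (simp add: isCont_def tendsto_at_iff_tendsto_nhds)
  hence "\<forall>\<^sub>F x in nhds 0. norm (f x) < norm (f 0) + 1"
    by (rule order_tendstoD) simp
  thus ?thesis
    unfolding vanishes_to_order_iff_eventually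
    by (intro exI[of _ "norm (f 0) + 1"]) (auto elim: eventually_mono)
qed

text \<open>The admissible exponents are closed downwards, so if \<open>m\<close> is not among them
  all of them are at most \<open>m - 1\<close>, and so is their supremum. The assumption settles
  \<open>m = 0\<close>, where the left side holds even for an empty set of exponents.\<close>

lemma enat_le_Ord_iff:
  assumes "vanishes_to_order f 0"
  shows "enat m \<le> Ord f \<longleftrightarrow> vanishes_to_order f m"
proof
  assume m: "enat m \<le> Ord f"
  show "vanishes_to_order f m"
  proof (rule ccontr)
    assume n: "\<not> vanishes_to_order f m"
    have "m \<noteq> 0" using assms n by (cases m) auto
    have "k \<le> m - 1" if "vanishes_to_order f k" for k
      using vanishes_to_order_mono[OF that, of m] n by (cases "m \<le> k") auto
    hence "Ord f \<le> enat (m - 1)"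
      unfolding Ord_def by (intro Sup_least) auto
    with m \<open>m \<noteq> 0\<close> show False by (cases "Ord f") auto
  qed
qed (auto simp: Ord_def intro: Sup_upper)

text \<open>Asks for a polynomial approximation instead of differentiability: this is stable under
  ring operations and still excludes oscillation, so that a function either vanishes to order
  \<open>n\<close> or has an exact smaller order.\<close>

definition taylor_upto :: "nat \<Rightarrow> (real \<Rightarrow> 'a :: real_normed_field) \<Rightarrow> bool" where
  "taylor_upto n f \<longleftrightarrow> (\<exists>P. vanishes_to_order (\<lambda>x. f x - poly P (of_real x)) n)"

lemma vanishes_to_order_0_poly:
  "vanishes_to_order (\<lambda>x. poly P (of_real x) :: 'a :: real_normed_field) 0"
  by (intro isCont_vanishes_to_order_0 continuous_intros isCont_of_real continuous_ident)

lemma taylor_upto_poly: "taylor_upto n (\<lambda>x. poly P (of_real x))"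
  unfolding taylor_upto_def by (rule exI[of _ P]) simp

lemma taylor_upto_vanishes_0:
  assumes "taylor_upto n f"
  shows "vanishes_to_order f 0"
proof -
  obtain P where "vanishes_to_order (\<lambda>x. f x - poly P (of_real x)) n"
    using assms by (auto simp: taylor_upto_def)
  from vanishes_to_order_add[OF vanishes_to_order_mono[OF this, of 0] vanishes_to_order_0_poly[of P]]
  show ?thesis by simp
qed

lemma taylor_upto_add:
  assumes "taylor_upto n f" "taylor_upto n g"
  shows "taylor_upto n (\<lambda>x. f x + g x)"
proof -
  obtain P R where "vanishes_to_order (\<lambda>x. f x - poly P (of_real x)) n"
      "vanishes_to_order (\<lambda>x. g x - poly R (of_real x)) n"
    using assms by (auto simp: taylor_upto_def)
  from vanishes_to_order_add[OF this] show ?thesis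
    unfolding taylor_upto_def by (intro exI[of _ "P + R"]) (simp add: algebra_simps)
qed

lemma taylor_upto_mult:
  assumes "taylor_upto n f" "taylor_upto n g"
  shows "taylor_upto n (\<lambda>x. f x * g x)"
proof -
  obtain P R where PR: "vanishes_to_order (\<lambda>x. f x - poly P (of_real x)) n"
      "vanishes_to_order (\<lambda>x. g x - poly R (of_real x)) n"
    using assms by (auto simp: taylor_upto_def)
  have "vanishes_to_order (\<lambda>x. (f x - poly P (of_real x)) * g x
      + poly P (of_real x) * (g x - poly R (of_real x))) n"
    using vanishes_to_order_mult[OF PR(1) taylor_upto_vanishes_0[OF assms(2)]]
      vanishes_to_order_mult[OF vanishes_to_order_0_poly PR(2), of P]
    by (intro vanishes_to_order_add) simp_all
  thus ?thesis
    unfolding taylor_upto_def by (intro exI[of _ "P * R"]) (simp add: algebra_simps)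
qed

lemma taylor_upto_const: "taylor_upto n (\<lambda>x. c)"
  using taylor_upto_poly[of n "[:c:]"] by simp

lemma taylor_upto_id: "taylor_upto n (\<lambda>x. of_real x)"
  using taylor_upto_poly[of n "[:0, 1:]"] by simp

lemma taylor_upto_power: "taylor_upto n f \<Longrightarrow> taylor_upto n (\<lambda>x. f x ^ k)"
  by (induction k) (auto intro: taylor_upto_mult taylor_upto_const)

lemma taylor_upto_uminus: "taylor_upto n f \<Longrightarrow> taylor_upto n (\<lambda>x. - f x)"
  using taylor_upto_mult[OF taylor_upto_const[of n "-1"], of f] by simp

lemma taylor_upto_diff:
  "taylor_upto n f \<Longrightarrow> taylor_upto n g \<Longrightarrow> taylor_upto n (\<lambda>x. f x - g x)"
  using taylor_upto_add[OF _ taylor_upto_uminus, of n f g] by simp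

lemma taylor_upto_sum:
  assumes "finite S" "\<And>s. s \<in> S \<Longrightarrow> taylor_upto n (f s)"
  shows "taylor_upto n (\<lambda>x. \<Sum>s\<in>S. f s x)"
  using assms by (induction S rule: finite_induct) (auto intro: taylor_upto_add taylor_upto_const)

lemma vanishes_imp_taylor_upto: "vanishes_to_order f n \<Longrightarrow> taylor_upto n f"
  unfolding taylor_upto_def by (intro exI[of _ 0]) simp

lemma poly_map_poly_of_real:
  "poly (map_poly of_real P) (of_real x) = (of_real (poly P x) :: 'a :: {real_algebra_1, comm_ring_1})"
  by (induction P) (auto simp: map_poly_pCons)

lemma taylor_upto_of_real:
  assumes "taylor_upto n f"
  shows "taylor_upto n (\<lambda>x. of_real (f x) :: 'a :: real_normed_field)"
proof -
  obtain P where P: "vanishes_to_order (\<lambda>x. f x - poly P x) n"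
    using assms by (auto simp: taylor_upto_def)
  have "norm (of_real (f x) - poly (map_poly of_real P) (of_real x) :: 'a) = norm (f x - poly P x)" for x
    unfolding poly_map_poly_of_real by (metis norm_of_real of_real_diff real_norm_def)
  with P show ?thesis
    unfolding taylor_upto_def vanishes_to_order_def by (intro exI[of _ "map_poly of_real P"]) simp
qed

text \<open>The exact order is the multiplicity of 0 as a root of the Taylor polynomial. Near 0 its
  lowest term dominates both its other terms and the approximation error.\<close>

lemma taylor_dichotomy:
  fixes f :: "real \<Rightarrow> 'a :: real_normed_field"
  assumes "taylor_upto n f" "\<not> vanishes_to_order f n"
  shows "\<exists>k<n. \<exists>c>0. \<forall>\<^sub>F x in nhds 0. c * \<bar>x\<bar> ^ k \<le> norm (f x)"
proof -
  obtain P where P: "vanishes_to_order (\<lambda>x. f x - poly P (of_real x)) n"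
    using assms by (auto simp: taylor_upto_def)
  have "P \<noteq> 0" using P assms(2) by auto
  define k where "k = order 0 P"
  obtain R where R: "P = [:- 0, 1:] ^ k * R" "\<not> [:- 0, 1:] dvd R"
    using order_decomp[OF \<open>P \<noteq> 0\<close>, of 0] by (auto simp: k_def)
  have R0: "poly R 0 \<noteq> 0" using R(2) by (simp add: poly_eq_0_iff_dvd)
  have Px: "poly P (of_real x) = of_real x ^ k * poly R (of_real x)" for x
    by (simp add: R(1) poly_power)
  \<comment> \<open>Otherwise the Taylor polynomial, and with it \<open>f\<close>, would vanish to
    order \<open>n\<close>.\<close>
  have "k < n"
  proof (rule ccontr)
    assume "\<not> k < n"
    hence "vanishes_to_order (\<lambda>x. poly P (of_real x)) n"
      using vanishes_to_order_mult[OF vanishes_to_order_power_id[of k] vanishes_to_order_0_poly[of R]]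
      by (auto simp: Px intro: vanishes_to_order_mono)
    from vanishes_to_order_add[OF P this] assms(2) show False by simp
  qed
  \<comment> \<open>Since \<open>norm (poly R 0) = 4 * c\<close>, continuity keeps the norm of
    \<open>R\<close> above \<open>2 * c\<close> near 0; one \<open>c\<close> pays for the error and
    the other remains.\<close>
  define c where "c = norm (poly R 0) / 4"
  have "c > 0" using R0 by (simp add: c_def)
  obtain C where C: "\<forall>\<^sub>F x in nhds 0. norm (f x - poly P (of_real x)) \<le> C * \<bar>x\<bar> ^ Suc k"
    using vanishes_to_order_mono[OF P, of "Suc k"] \<open>k < n\<close>
    by (auto simp: vanishes_to_order_iff_eventually)
  have "isCont (\<lambda>x. poly R (of_real x :: 'a)) 0"
    by (intro continuous_intros isCont_of_real continuous_ident)
  hence "((\<lambda>x. poly R (of_real x)) \<longlongrightarrow> poly R (of_real 0)) (nhds (0::real))"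
    unfolding isCont_def
    by (rule tendsto_at_iff_tendsto_nhds[of "\<lambda>x. poly R (of_real x)" 0, THEN iffD1])
  hence "((\<lambda>x. norm (poly R (of_real x))) \<longlongrightarrow> norm (poly R 0)) (nhds (0::real))"
    by (auto dest: tendsto_norm)
  hence ev: "\<forall>\<^sub>F x in nhds (0::real). norm (poly R (of_real x)) > 2 * c"
    by (rule order_tendstoD) (use R0 in \<open>simp add: c_def\<close>)
  \<comment> \<open>On this range the error \<open>C * \<bar>x\<bar> ^ Suc k\<close> is at most
    \<open>c * \<bar>x\<bar> ^ k\<close>; the added 1 keeps the denominator positive.\<close>
  have "\<forall>\<^sub>F x in nhds 0. \<bar>x\<bar> < c / (\<bar>C\<bar> + 1)"
    using \<open>c > 0\<close> by (intro eventually_nhds_0_abs_less) auto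
  with C ev have "\<forall>\<^sub>F x in nhds 0. c * \<bar>x\<bar> ^ k \<le> norm (f x)"
  proof eventually_elim
    case (elim x)
    have "C * \<bar>x\<bar> \<le> (\<bar>C\<bar> + 1) * \<bar>x\<bar>" by (intro mult_right_mono) auto
    also have "\<dots> \<le> c" using elim(3) by (simp add: pos_less_divide_eq mult.commute)
    finally have "C * \<bar>x\<bar> * \<bar>x\<bar> ^ k \<le> c * \<bar>x\<bar> ^ k" by (intro mult_right_mono) auto
    moreover have "2 * c * \<bar>x\<bar> ^ k \<le> norm (poly P (of_real x))"
      using mult_right_mono[OF less_imp_le[OF elim(2)], of "\<bar>x\<bar> ^ k"]
      by (simp add: Px norm_mult norm_power mult_ac)
    moreover have "norm (poly P (of_real x)) \<le> norm (f x) + norm (f x - poly P (of_real x))"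
      by norm
    ultimately show ?case using elim(1) by (simp add: algebra_simps)
  qed
  thus ?thesis using \<open>k < n\<close> \<open>c > 0\<close> by blast
qed

text \<open>Order \<open>K\<close> rules out vanishing to order \<open>Suc K\<close>, so the
  dichotomy yields a lower bound with some exponent at most \<open>K\<close>, which is stronger for
  small x.\<close>

lemma Ord_eq_enat_imp_lower_bound:
  fixes f :: "real \<Rightarrow> 'a :: real_normed_field"
  assumes "taylor_upto (Suc K) f" "Ord f = enat K"
  shows "\<exists>c>0. \<forall>\<^sub>F x in nhds 0. c * \<bar>x\<bar> ^ K \<le> norm (f x)"
proof -
  have "\<not> vanishes_to_order f (Suc K)"
    using enat_le_Ord_iff[OF taylor_upto_vanishes_0[OF assms(1)], of "Suc K"] assms(2) by simp
  then obtain k c where k: "k \<le> K" "c > 0" "\<forall>\<^sub>F x in nhds 0. c * \<bar>x\<bar> ^ k \<le> norm (f x)"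
    using taylor_dichotomy[OF assms(1)] by (auto simp: less_Suc_eq_le)
  from k(3) eventually_nhds_0_abs_less[OF zero_less_one]
  have "\<forall>\<^sub>F x in nhds 0. c * \<bar>x\<bar> ^ K \<le> norm (f x)"
  proof eventually_elim
    case (elim x)
    have "c * \<bar>x\<bar> ^ K \<le> c * \<bar>x\<bar> ^ k"
      using k elim by (intro mult_left_mono power_decreasing) auto
    with elim(1) show ?case by linarith
  qed
  with k(2) show ?thesis by blast
qed

section \<open>Taylor expansions of power series, also along a branch\<close>

lemma taylor_upto_eval_ps1:
  assumes "conv_ps1 c"
  shows "taylor_upto n (eval_ps1 c)"
proof -
  obtain r where r: "r > 0" "summable (\<lambda>k. \<bar>c k\<bar> * r ^ k)"
    using assms by (auto simp: conv_ps1_def)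
  define P where "P = (\<Sum>k<n. monom (c k) k)"
  define K where "K = (\<Sum>k. \<bar>c (k + n)\<bar> * r ^ k)"
  have shift: "summable (\<lambda>k. \<bar>c (k + n)\<bar> * r ^ k)"
    using summable_mult[OF summable_ignore_initial_segment[OF r(2), of n], of "1 / r ^ n"] r(1)
    by (simp add: power_add field_simps)
  have "\<forall>\<^sub>F x in nhds 0. norm (eval_ps1 c x - poly P x) \<le> K * \<bar>x\<bar> ^ n"
    using eventually_nhds_0_abs_less[OF r(1)]
  proof eventually_elim
    case (elim x)
    have le: "norm (c k * x ^ k) \<le> \<bar>c k\<bar> * r ^ k" for k
      using elim by (auto simp: abs_mult power_abs intro!: mult_left_mono power_mono)
    have le': "norm (c (k + n) * x ^ k) \<le> \<bar>c (k + n)\<bar> * r ^ k" for k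
      using elim by (auto simp: abs_mult power_abs intro!: mult_left_mono power_mono)
    have s: "summable (\<lambda>k. c k * x ^ k)"
      by (rule summable_comparison_test'[OF r(2) le])
    have s': "summable (\<lambda>k. c (k + n) * x ^ k)"
      by (rule summable_comparison_test'[OF shift le'])
    have "eval_ps1 c x - poly P x = (\<Sum>k. c (k + n) * x ^ (k + n))"
      using suminf_split_initial_segment[OF s, of n]
      by (simp add: eval_ps1_def P_def poly_sum poly_monom)
    also have "\<dots> = (\<Sum>k. c (k + n) * x ^ k) * x ^ n"
      using suminf_mult2[OF s', of "x ^ n"] by (simp add: power_add mult_ac)
    finally have "norm (eval_ps1 c x - poly P x) = norm (\<Sum>k. c (k + n) * x ^ k) * \<bar>x\<bar> ^ n"
      by (simp add: abs_mult power_abs)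
    moreover have "norm (\<Sum>k. c (k + n) * x ^ k) \<le> K"
      unfolding K_def by (rule norm_suminf_le[OF le' shift])
    ultimately show ?case by (simp add: mult_right_mono)
  qed
  thus ?thesis
    unfolding taylor_upto_def vanishes_to_order_iff_eventually by (intro exI[of _ P]) auto
qed

text \<open>Only finitely many terms have total degree below \<open>n\<close>, and each of them
  inherits an expansion from \<open>a\<close>. Both arguments are O(x), so the terms of total degree
  at least \<open>n\<close> add up to O(x^n).\<close>

lemma taylor_upto_eval_ps2:
  assumes c: "conv_ps2 c" and a: "taylor_upto n a" "vanishes_to_order a 1"
  shows "taylor_upto n (\<lambda>x. eval_ps2 c (of_real x) (of_real (a x)))"
proof -
  obtain r where r: "r > 0" "(\<lambda>(i,j). norm (c i j) * r ^ (i + j)) summable_on UNIV"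
    using c by (rule conv_ps2_radius)
  obtain C where C: "C > 0" "\<forall>\<^sub>F x in nhds 0. \<bar>a x\<bar> \<le> C * \<bar>x\<bar>"
    using a(2) by (auto simp: vanishes_to_order_def eventually_nhds_metric dist_real_def)
  define S where "S = {(i,j). i + j < n}"
  have S: "finite S"
    by (rule finite_subset[of _ "{..<n} \<times> {..<n}"]) (auto simp: S_def)
  define K where "K = (\<Sum>\<^sub>\<infinity>(i,j)\<in>-S. norm (c i j) * r ^ (i + j))"
  \<comment> \<open>With \<open>s = D * \<bar>x\<bar>\<close>, the radius
    \<open>r * s = (C + 1) * \<bar>x\<bar>\<close> dominates both arguments of the series, and
    \<open>\<bar>x\<bar> < 1 / D\<close> gives \<open>s \<le> 1\<close>. Each tail term then gains a
    factor of at most \<open>s ^ n\<close>.\<close>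
  define D where "D = (C + 1) / r"
  have head: "taylor_upto n (\<lambda>x. \<Sum>(i,j)\<in>S. c i j * of_real x ^ i * of_real (a x) ^ j)"
    using S a(1) unfolding split_def
    by (intro taylor_upto_sum taylor_upto_mult taylor_upto_const taylor_upto_power
        taylor_upto_id taylor_upto_of_real)
  have "\<forall>\<^sub>F x in nhds 0. \<bar>x\<bar> < 1 / D"
    using r C by (intro eventually_nhds_0_abs_less) (auto simp: D_def)
  with C(2) have "\<forall>\<^sub>F x in nhds 0. norm (eval_ps2 c (of_real x) (of_real (a x))
      - (\<Sum>(i,j)\<in>S. c i j * of_real x ^ i * of_real (a x) ^ j)) \<le> (K * D ^ n) * \<bar>x\<bar> ^ n"
  proof eventually_elim
    case (elim x)
    define s where "s = D * \<bar>x\<bar>"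
    have s: "0 \<le> s" "s \<le> 1"
      using elim r C by (auto simp: s_def D_def field_simps)
    have "r * s = (C + 1) * \<bar>x\<bar>" using r by (simp add: s_def D_def)
    hence xs: "norm (complex_of_real x) \<le> r * s" "norm (complex_of_real (a x)) \<le> r * s"
      using elim(1) C(1) by (auto simp: distrib_right)
    have "r * s \<le> r" using s r by (simp add: mult_left_le)
    with xs have xr: "norm (complex_of_real x) \<le> r" "norm (complex_of_real (a x)) \<le> r" by auto
    define T where "T = (\<lambda>(i,j). c i j * complex_of_real x ^ i * complex_of_real (a x) ^ j)"
    have "infsum T UNIV = infsum T (S \<union> - S)" by simp
    also have "\<dots> = infsum T S + infsum T (- S)"
      using ps2_summable[OF r(2) xr] by (intro infsum_Un_disjoint) (auto simp: T_def)
    finally have "eval_ps2 c (of_real x) (of_real (a x)) - sum T S = infsum T (- S)"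
      using S by (simp add: eval_ps2_def T_def)
    moreover have "norm (infsum T (- S)) \<le> (\<Sum>\<^sub>\<infinity>k\<in>-S. (case k of (i,j) \<Rightarrow> norm (c i j) * r ^ (i + j)) * s ^ n)"
    proof (rule norm_infsum_le_infsum)
      show "(\<lambda>k. (case k of (i,j) \<Rightarrow> norm (c i j) * r ^ (i + j)) * s ^ n) summable_on - S"
        by (rule summable_on_cmult_left, rule summable_on_subset_banach[OF r(2)]) auto
      fix k assume "k \<in> - S"
      then obtain i j where k: "k = (i,j)" "i + j \<ge> n" by (force simp: S_def)
      have "norm (T k) \<le> norm (c i j) * (r * s) ^ (i + j)"
        using ps2_term_le[OF xs] by (simp add: T_def k)
      also have "\<dots> = norm (c i j) * r ^ (i + j) * s ^ (i + j)" by (simp add: power_mult_distrib)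
      also have "\<dots> \<le> norm (c i j) * r ^ (i + j) * s ^ n"
        using r s k by (intro mult_left_mono power_decreasing) auto
      finally show "norm (T k) \<le> (case k of (i,j) \<Rightarrow> norm (c i j) * r ^ (i + j)) * s ^ n"
        by (simp add: k)
    qed
    moreover have "(\<Sum>\<^sub>\<infinity>k\<in>-S. (case k of (i,j) \<Rightarrow> norm (c i j) * r ^ (i + j)) * s ^ n) = K * s ^ n"
      unfolding K_def by (rule infsum_cmult_left, rule summable_on_subset_banach[OF r(2)]) auto
    ultimately show ?case by (simp add: T_def s_def power_mult_distrib mult_ac)
  qed
  hence "taylor_upto n (\<lambda>x. eval_ps2 c (of_real x) (of_real (a x))
      - (\<Sum>(i,j)\<in>S. c i j * of_real x ^ i * of_real (a x) ^ j))"
    by (intro vanishes_imp_taylor_upto) (auto simp: vanishes_to_order_iff_eventually)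
  from taylor_upto_add[OF this head] show ?thesis by simp
qed

subsection \<open>One-dimensional integrals\<close>

lemma nn_integral_abs_powr_finite:
  fixes \<beta> d :: real
  assumes "\<beta> > -1" "d > 0"
  shows "(\<integral>\<^sup>+x\<in>{-d<..<d}. ennreal (\<bar>x\<bar> powr \<beta>) \<partial>lborel) < \<infinity>"
proof -
  define f where "f = (\<lambda>x::real. ennreal (x powr \<beta>) * indicator {0..d} x)"
  have [measurable]: "f \<in> borel_measurable borel" by (simp add: f_def)
  obtain I where I: "((\<lambda>x. x powr \<beta>) has_integral I) {0..d}"
    using integrable_on_powr_from_0[of \<beta> d] assms by (auto simp: integrable_on_def)
  have f: "integral\<^sup>N lborel f = ennreal I"
    unfolding f_def by (rule nn_integral_has_integral_lebesgue'[OF _ I]) auto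
  \<comment> \<open>The integrand on the right half-interval and its reflection together cover both
    signs of x.\<close>
  have "(\<integral>\<^sup>+x\<in>{-d<..<d}. ennreal (\<bar>x\<bar> powr \<beta>) \<partial>lborel) \<le> (\<integral>\<^sup>+x. f x + f (0 + (-1) * x) \<partial>lborel)"
    by (intro nn_integral_mono) (auto simp: f_def indicator_def abs_if)
  also have "\<dots> = integral\<^sup>N lborel f + (\<integral>\<^sup>+x. f (0 + (-1) * x) \<partial>lborel)"
    by (intro nn_integral_add) auto
  also have "(\<integral>\<^sup>+x. f (0 + (-1) * x) \<partial>lborel) = integral\<^sup>N lborel f"
    by (subst nn_integral_real_affine[of f "-1" 0]) auto
  also have "integral\<^sup>N lborel f + integral\<^sup>N lborel f < \<infinity>" by (simp add: f)
  finally show ?thesis .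
qed

text \<open>Translation by \<open>a\<close> moves the interval inside one of twice its length, which
  makes the bound uniform in \<open>a\<close>.\<close>

lemma nn_integral_shifted_abs_powr_le:
  fixes a d \<beta> :: real
  assumes "\<bar>a\<bar> < d"
  shows "(\<integral>\<^sup>+y\<in>{-d<..<d}. ennreal (\<bar>y - a\<bar> powr \<beta>) \<partial>lborel)
    \<le> (\<integral>\<^sup>+u\<in>{-(2*d)<..<2*d}. ennreal (\<bar>u\<bar> powr \<beta>) \<partial>lborel)"
proof -
  have "(\<integral>\<^sup>+y\<in>{-d<..<d}. ennreal (\<bar>y - a\<bar> powr \<beta>) \<partial>lborel)
      = (\<integral>\<^sup>+y. ennreal (\<bar>a + 1 * y - a\<bar> powr \<beta>) * indicator {-d<..<d} (a + 1 * y) \<partial>lborel)"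
    by (subst nn_integral_real_affine[of _ 1 a]) auto
  also have "\<dots> \<le> (\<integral>\<^sup>+u\<in>{-(2*d)<..<2*d}. ennreal (\<bar>u\<bar> powr \<beta>) \<partial>lborel)"
    using assms by (intro nn_integral_mono) (auto simp: indicator_def)
  finally show ?thesis .
qed

lemma nn_integral_inverse_infinite:
  fixes c d :: real
  assumes "c > 0" "d > 0"
  shows "(\<integral>\<^sup>+x\<in>{0<..<d}. ennreal (c / x) \<partial>lborel) = \<infinity>"
proof -
  define D where "D = d / 2"
  have D: "D > 0" "D < d" using assms by (auto simp: D_def)
  have "ennreal B \<le> (\<integral>\<^sup>+x\<in>{0<..<d}. ennreal (c / x) \<partial>lborel)" if "B > 0" for B
  proof -
    \<comment> \<open>Chosen so that the integral from \<open>\<epsilon>\<close> to \<open>D\<close>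
      equals \<open>B\<close> exactly.\<close>
    define \<epsilon> where "\<epsilon> = D * exp (- B / c)"
    have \<epsilon>: "0 < \<epsilon>" "\<epsilon> \<le> D"
      using D that assms by (auto simp: \<epsilon>_def mult_left_le)
    have "(\<integral>\<^sup>+x. ennreal (c / x) * indicator {\<epsilon>..D} x \<partial>lborel) = ennreal (c * ln D - c * ln \<epsilon>)"
    proof (rule nn_integral_FTC_Icc)
      fix x assume "x \<in> {\<epsilon>..D}"
      hence "\<epsilon> \<le> x" by simp
      thus "DERIV (\<lambda>x. c * ln x) x :> c / x"
        using \<epsilon> by (auto intro!: derivative_eq_intros)
      show "0 \<le> c / x" using \<epsilon> \<open>\<epsilon> \<le> x\<close> assms by auto
    qed (use \<epsilon> in auto)
    also have "c * ln D - c * ln \<epsilon> = B"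
      using D assms by (simp add: \<epsilon>_def ln_mult algebra_simps)
    finally have "ennreal B = (\<integral>\<^sup>+x. ennreal (c / x) * indicator {\<epsilon>..D} x \<partial>lborel)" ..
    also have "\<dots> \<le> (\<integral>\<^sup>+x\<in>{0<..<d}. ennreal (c / x) \<partial>lborel)"
      using \<epsilon> D by (intro nn_integral_mono) (auto simp: indicator_def)
    finally show ?thesis .
  qed
  note ge = this
  have "(\<integral>\<^sup>+x\<in>{0<..<d}. ennreal (c / x) \<partial>lborel) \<noteq> ennreal r" if "r \<ge> 0" for r
    using ge[of "r + 1"] that by (auto simp: ennreal_le_iff)
  thus ?thesis by (cases "(\<integral>\<^sup>+x\<in>{0<..<d}. ennreal (c / x) \<partial>lborel)") auto
qed

text \<open>With \<open>s\<close> the second factor on the right, the 1 and every \<open>b j\<close>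
  are at most \<open>s powr (1 / p)\<close>, and there are \<open>1 + card S\<close> such
  summands.\<close>

lemma one_plus_sum_powr_le:
  fixes b :: "'i \<Rightarrow> real"
  assumes "finite S" "\<And>j. j \<in> S \<Longrightarrow> 0 \<le> b j" "1 \<le> p"
  shows "(1 + (\<Sum>j\<in>S. b j)) powr p \<le> (1 + real (card S)) powr p * (1 + (\<Sum>j\<in>S. b j powr p))"
proof -
  define s where "s = 1 + (\<Sum>j\<in>S. b j powr p)"
  have s: "1 \<le> s" by (simp add: s_def sum_nonneg)
  have "b j \<le> s powr (1 / p)" if "j \<in> S" for j
  proof -
    have "b j powr p \<le> s"
      using member_le_sum[OF that, of "\<lambda>j. b j powr p"] assms(1) by (simp add: s_def)
    hence "(b j powr p) powr (1 / p) \<le> s powr (1 / p)"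
      using assms by (intro powr_mono2) auto
    thus ?thesis using assms that by (simp add: powr_powr)
  qed
  hence "(\<Sum>j\<in>S. b j) \<le> real (card S) * s powr (1 / p)"
    using sum_bounded_above[of S b] by simp
  moreover have "1 \<le> s powr (1 / p)" using s assms by (simp add: ge_one_powr_ge_zero)
  ultimately have "1 + (\<Sum>j\<in>S. b j) \<le> (1 + real (card S)) * s powr (1 / p)"
    by (simp add: algebra_simps)
  hence "(1 + (\<Sum>j\<in>S. b j)) powr p \<le> ((1 + real (card S)) * s powr (1 / p)) powr p"
    using assms by (intro powr_mono2) (auto intro!: add_nonneg_nonneg sum_nonneg)
  also have "\<dots> = (1 + real (card S)) powr p * s"
    using s assms by (simp add: powr_mult powr_powr)
  finally show ?thesis by (simp add: s_def)
qed

text \<open>Splitting \<open>(A + B) powr -p \<le> A powr -\<alpha> * B powr -(p - \<alpha>)\<close> with \<open>\<alpha> < 1\<close> close to 1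
  covers \<open>p = 1\<close>, where the integral is logarithmic in \<open>x\<close>, together with \<open>p > 1\<close>.\<close>

lemma nn_integral_kernel_le:
  fixes s p d :: real and e :: nat
  assumes p: "1 \<le> p" and "d > 0" and s: "p * s - e * (p - 1) > -1"
  shows "\<exists>\<beta> I. -1 < \<beta> \<and> I < (\<infinity>::ennreal) \<and> (\<forall>x a. x \<noteq> 0 \<longrightarrow> \<bar>a\<bar> < d \<longrightarrow>
    (\<integral>\<^sup>+y\<in>{-d<..<d}. ennreal ((\<bar>x\<bar> powr s / (\<bar>y - a\<bar> + \<bar>x\<bar> ^ e)) powr p) \<partial>lborel)
      \<le> I * ennreal (\<bar>x\<bar> powr \<beta>))"
proof -
  \<comment> \<open>\<open>g\<close> is the margin in the hypothesis on the exponents. Replacing the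
    ideal value 1 by \<open>\<alpha>\<close> costs \<open>e * (1 - \<alpha>)\<close>, which the
    choice of \<open>\<alpha>\<close> keeps below \<open>g\<close>; the minimum with 1/2 keeps
    \<open>\<alpha>\<close> positive. The remaining exponent is
    \<open>\<beta> = g - 1 - e * (1 - \<alpha>)\<close>.\<close>
  define g where "g = p * s - e * (p - 1) + 1"
  define \<alpha> where "\<alpha> = 1 - min (1/2) (g / (2 * (real e + 1)))"
  define \<beta> where "\<beta> = p * s - e * (p - \<alpha>)"
  have g: "g > 0" using s by (simp add: g_def)
  have \<alpha>: "0 < \<alpha>" "\<alpha> < 1" using g by (auto simp: \<alpha>_def min_def)
  have "real e * (1 - \<alpha>) \<le> real e * (g / (2 * (real e + 1)))"
    by (intro mult_left_mono) (auto simp: \<alpha>_def)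
  also have "\<dots> < g" using g by (simp add: field_simps add_nonneg_pos)
  finally have \<beta>: "\<beta> > -1" by (simp add: \<beta>_def g_def algebra_simps)
  define I where "I = (\<integral>\<^sup>+u\<in>{-(2*d)<..<2*d}. ennreal (\<bar>u\<bar> powr (-\<alpha>)) \<partial>lborel)"
  have I: "I < \<infinity>" unfolding I_def using \<alpha> \<open>d > 0\<close> by (intro nn_integral_abs_powr_finite) auto
  have "(\<integral>\<^sup>+y\<in>{-d<..<d}. ennreal ((\<bar>x\<bar> powr s / (\<bar>y - a\<bar> + \<bar>x\<bar> ^ e)) powr p) \<partial>lborel)
      \<le> I * ennreal (\<bar>x\<bar> powr \<beta>)" if x: "x \<noteq> 0" and a: "\<bar>a\<bar> < d" for x a
  proof -
    have pw: "(\<bar>x\<bar> powr s / (\<bar>y - a\<bar> + \<bar>x\<bar> ^ e)) powr p \<le> \<bar>y - a\<bar> powr (-\<alpha>) * \<bar>x\<bar> powr \<beta>"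
      if "y \<noteq> a" for y
    proof -
      define A where "A = \<bar>y - a\<bar>"
      define B where "B = \<bar>x\<bar> ^ e"
      have AB: "A > 0" "B > 0" using that x by (auto simp: A_def B_def)
      have "A powr \<alpha> * B powr (p - \<alpha>) \<le> (A + B) powr \<alpha> * (A + B) powr (p - \<alpha>)"
        using AB \<alpha> p by (intro mult_mono powr_mono2) auto
      also have "\<dots> = (A + B) powr p" by (simp flip: powr_add)
      finally have le: "A powr \<alpha> * B powr (p - \<alpha>) \<le> (A + B) powr p" .
      have "(\<bar>x\<bar> powr s / (A + B)) powr p = \<bar>x\<bar> powr (s * p) / (A + B) powr p"
        using AB by (simp add: powr_divide powr_powr)
      also have "\<dots> \<le> \<bar>x\<bar> powr (s * p) / (A powr \<alpha> * B powr (p - \<alpha>))"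
        using le AB by (intro divide_left_mono) auto
      also have "B powr (p - \<alpha>) = \<bar>x\<bar> powr (e * (p - \<alpha>))"
        using x by (simp add: B_def powr_powr flip: powr_realpow)
      also have "\<bar>x\<bar> powr (s * p) / (A powr \<alpha> * \<bar>x\<bar> powr (e * (p - \<alpha>))) = A powr (-\<alpha>) * \<bar>x\<bar> powr \<beta>"
        by (simp add: \<beta>_def powr_diff powr_minus_divide mult_ac)
      finally show ?thesis by (simp add: A_def B_def)
    qed
    have "(\<integral>\<^sup>+y\<in>{-d<..<d}. ennreal ((\<bar>x\<bar> powr s / (\<bar>y - a\<bar> + \<bar>x\<bar> ^ e)) powr p) \<partial>lborel)
        \<le> (\<integral>\<^sup>+y. (ennreal (\<bar>y - a\<bar> powr (-\<alpha>)) * indicator {-d<..<d} y) * ennreal (\<bar>x\<bar> powr \<beta>) \<partial>lborel)"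
    proof (rule nn_integral_mono_AE, rule eventually_mono[OF AE_lborel_singleton[of a]])
      \<comment> \<open>The point \<open>y = a\<close> must be left out because
        \<open>0 powr (-\<alpha>)\<close> is 0, so the pointwise bound fails there; it is a null
        set.\<close>
      fix y assume "y \<noteq> a"
      thus "ennreal ((\<bar>x\<bar> powr s / (\<bar>y - a\<bar> + \<bar>x\<bar> ^ e)) powr p) * indicator {-d<..<d} y
        \<le> (ennreal (\<bar>y - a\<bar> powr (-\<alpha>)) * indicator {-d<..<d} y) * ennreal (\<bar>x\<bar> powr \<beta>)"
        using pw[of y] by (auto simp: indicator_def ennreal_mult[symmetric] intro!: ennreal_leI)
    qed
    also have "\<dots> = (\<integral>\<^sup>+y\<in>{-d<..<d}. ennreal (\<bar>y - a\<bar> powr (-\<alpha>)) \<partial>lborel) * ennreal (\<bar>x\<bar> powr \<beta>)"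
      by (rule nn_integral_multc) auto
    also have "\<dots> \<le> I * ennreal (\<bar>x\<bar> powr \<beta>)"
      unfolding I_def by (intro mult_right_mono nn_integral_shifted_abs_powr_le a) auto
    finally show ?thesis .
  qed
  with \<beta> I show ?thesis by blast
qed

text \<open>On \<open>U\<close> the function is a pointwise limit of polynomials. The indicator
  removes the points where convergence is not known.\<close>

lemma eval_ps2_indicator_measurable:
  assumes r: "(\<lambda>(i,j). norm (c i j) * r ^ (i + j)) summable_on UNIV"
    and U: "U \<in> sets borel" "\<And>z. z \<in> U \<Longrightarrow> \<bar>fst z\<bar> \<le> r \<and> \<bar>snd z\<bar> \<le> r"
  shows "(\<lambda>z. indicator U z *\<^sub>R eval_ps2 c (of_real (fst z)) (of_real (snd z)))
    \<in> borel_measurable (borel :: (real \<times> real) measure)"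
proof (rule borel_measurable_LIMSEQ_metric)
  fix n :: nat
  let ?F = "\<lambda>z::real \<times> real. \<Sum>(i,j)\<in>{..<n} \<times> {..<n}. c i j * of_real (fst z) ^ i * of_real (snd z) ^ j"
  have "?F \<in> borel_measurable borel"
    unfolding split_def by (intro borel_measurable_continuous_onI continuous_intros)
  thus "(\<lambda>z. indicator U z *\<^sub>R ?F z) \<in> borel_measurable borel"
    using U(1) by (intro borel_measurable_scaleR borel_measurable_indicator) auto
next
  fix z :: "real \<times> real"
  define T where "T = (\<lambda>(i,j). c i j * complex_of_real (fst z) ^ i * complex_of_real (snd z) ^ j)"
  \<comment> \<open>Square index sets eventually contain any finite set of indices, so the unordered
    sum is the limit of the square partial sums.\<close>
  have lim: "filterlim (\<lambda>n::nat. {..<n} \<times> {..<n}) (finite_subsets_at_top UNIV) sequentially"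
    unfolding filterlim_finite_subsets_at_top
  proof (intro allI impI)
    fix X :: "(nat \<times> nat) set" assume "finite X \<and> X \<subseteq> UNIV"
    hence "finite (fst ` X \<union> snd ` X)" by auto
    then obtain N where N: "\<forall>k\<in>fst ` X \<union> snd ` X. k < N"
      by (auto simp: finite_nat_set_iff_bounded)
    show "\<forall>\<^sub>F n in sequentially. finite ({..<n} \<times> {..<n}) \<and> X \<subseteq> {..<n} \<times> {..<n} \<and> {..<n} \<times> {..<n} \<subseteq> UNIV"
      using eventually_ge_at_top[of N] 
    proof eventually_elim
      case (elim n)
      have "i < n" "j < n" if "(i, j) \<in> X" for i j
        using bspec[OF N, of i] bspec[OF N, of j] image_eqI[OF _ that, of _ fst]
          image_eqI[OF _ that, of _ snd] elim by auto
      thus ?case by auto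
    qed
  qed
  show "(\<lambda>n. indicator U z *\<^sub>R sum T ({..<n} \<times> {..<n}))
      \<longlonglongrightarrow> indicator U z *\<^sub>R eval_ps2 c (of_real (fst z)) (of_real (snd z))"
  proof (cases "z \<in> U")
    case True
    hence "norm (complex_of_real (fst z)) \<le> r" "norm (complex_of_real (snd z)) \<le> r"
      using U(2) by auto
    hence "(T has_sum eval_ps2 c (of_real (fst z)) (of_real (snd z))) UNIV"
      unfolding T_def eval_ps2_def by (intro has_sum_infsum ps2_summable[OF r])
    hence "(\<lambda>n. sum T ({..<n} \<times> {..<n})) \<longlonglongrightarrow> eval_ps2 c (of_real (fst z)) (of_real (snd z))"
      unfolding has_sum_def by (rule filterlim_compose[OF _ lim])
    thus ?thesis by (intro tendsto_scaleR tendsto_const)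
  qed simp
qed

subsection \<open>The integrability criterion for systems of branches\<close>

text \<open>Only the sizes of the branches \<open>a j\<close>, of their differences and of \<open>P\<close> matter for the
  integrability criterion; \<open>e j\<close> stands for \<open>2 L\<^sub>j\<close> and \<open>K i j\<close> for \<open>O\<^sub>i\<^sub>j\<close>.\<close>

locale branch_system =
  fixes M :: nat and e :: "nat \<Rightarrow> nat" and K :: "nat \<Rightarrow> nat \<Rightarrow> nat"
    and a :: "nat \<Rightarrow> real \<Rightarrow> real" and P :: "real \<Rightarrow> real \<Rightarrow> complex"
  assumes e_pos: "j < M \<Longrightarrow> 1 \<le> e j"
    and K_diag: "j < M \<Longrightarrow> K j j = e j"
    and K_le: "i < M \<Longrightarrow> j < M \<Longrightarrow> K i j \<le> e i" "i < M \<Longrightarrow> j < M \<Longrightarrow> K i j \<le> e j"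
    and a_vanishes: "j < M \<Longrightarrow> vanishes_to_order (a j) 1"
    and a_taylor: "j < M \<Longrightarrow> taylor_upto n (a j)"
    and a_diff_upper: "i < M \<Longrightarrow> j < M \<Longrightarrow> i \<noteq> j \<Longrightarrow> vanishes_to_order (\<lambda>x. a j x - a i x) (K i j)"
    and a_diff_lower: "i < M \<Longrightarrow> j < M \<Longrightarrow> i \<noteq> j \<Longrightarrow>
      \<exists>c>0. \<forall>\<^sub>F x in nhds 0. c * \<bar>x\<bar> ^ K i j \<le> \<bar>a j x - a i x\<bar>"
    and P_lower: "\<exists>c>0. \<forall>\<^sub>F x in nhds 0. \<forall>y. c * (\<Prod>j<M. \<bar>y - a j x\<bar> + \<bar>x\<bar> ^ e j) \<le> norm (P x y)"
    and P_upper: "\<exists>C>0. \<forall>\<^sub>F x in nhds 0. \<forall>y. norm (P x y) \<le> C * (\<Prod>j<M. \<bar>y - a j x\<bar> + \<bar>x\<bar> ^ e j)"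
    and P_measurable: "(\<lambda>z. P (fst z) (snd z)) \<in> borel_measurable borel"
begin

section \<open>Sufficiency of the order conditions\<close>

lemma branches_eventually_less:
  assumes "r > 0"
  shows "\<forall>\<^sub>F x in nhds 0. \<forall>j\<in>{..<M}. \<bar>a j x\<bar> < r"
proof (intro eventually_ball_finite ballI)
  fix j assume "j \<in> {..<M}"
  then obtain C where C: "C > 0" "\<forall>\<^sub>F x in nhds 0. \<bar>a j x\<bar> \<le> C * \<bar>x\<bar>"
    using a_vanishes[of j] by (auto simp: vanishes_to_order_def eventually_nhds_metric dist_real_def)
  have "\<forall>\<^sub>F x in nhds 0. \<bar>x\<bar> < r / C"
    using C assms by (intro eventually_nhds_0_abs_less) auto
  with C(2) show "\<forall>\<^sub>F x in nhds 0. \<bar>a j x\<bar> < r"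
    by eventually_elim (use C in \<open>auto simp: field_simps\<close>)
qed simp

text \<open>In the j-th Lagrange term the numerators are bounded by all factors of the comparison
  product for \<open>P\<close> except the j-th, so division by \<open>P\<close> leaves a single
  denominator. The exponent \<open>s j\<close> is the order of \<open>Q\<close> along the branch
  minus the orders of the node differences. For \<open>x \<noteq> 0\<close> the nodes are
  distinct.\<close>

lemma quotient_bound:
  assumes c: "conv_ps2 c"
    and m: "\<And>j. j < M \<Longrightarrow> vanishes_to_order (\<lambda>x. eval_ps2 c (of_real x) (of_real (a j x))) (m j)"
  defines "s \<equiv> \<lambda>j. real (m j) - (\<Sum>i\<in>{..<M} - {j}. real (K i j))"
  shows "\<exists>C\<ge>0. \<exists>d>0. \<forall>x y. x \<noteq> 0 \<longrightarrow> \<bar>x\<bar> < d \<longrightarrow> \<bar>y\<bar> < d \<longrightarrow>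
    norm (eval_ps2 c (of_real x) (of_real y) / P x y)
      \<le> C * (1 + (\<Sum>j<M. \<bar>x\<bar> powr s j / (\<bar>y - a j x\<bar> + \<bar>x\<bar> ^ e j)))"
proof -
  define Q where "Q = (\<lambda>x y. eval_ps2 c (of_real x) (of_real y))"
  obtain r where r: "r > 0" "(\<lambda>(i,j). norm (c i j) * r ^ (i + j)) summable_on UNIV"
    using c by (rule conv_ps2_radius)
  have "\<forall>j\<in>{..<M}. \<exists>C. C > 0 \<and> (\<forall>\<^sub>F x in nhds 0. norm (Q x (a j x)) \<le> C * \<bar>x\<bar> ^ m j)"
    using m by (auto simp: Q_def vanishes_to_order_def eventually_nhds_metric dist_real_def)
  then obtain CQ where CQ: "\<forall>j\<in>{..<M}. CQ j > 0"
      "\<forall>j\<in>{..<M}. \<forall>\<^sub>F x in nhds 0. norm (Q x (a j x)) \<le> CQ j * \<bar>x\<bar> ^ m j"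
    by (auto dest!: bchoice)
  define I where "I = {(i,j). i < M \<and> j < M \<and> i \<noteq> j}"
  have "finite I" by (rule finite_subset[of _ "{..<M} \<times> {..<M}"]) (auto simp: I_def)
  have "\<forall>k\<in>I. \<exists>c. c > 0 \<and> (\<forall>\<^sub>F x in nhds 0. c * \<bar>x\<bar> ^ K (fst k) (snd k) \<le> \<bar>a (snd k) x - a (fst k) x\<bar>)"
    using a_diff_lower by (auto simp: I_def)
  then obtain cD where "\<forall>k\<in>I. cD k > 0 \<and>
      (\<forall>\<^sub>F x in nhds 0. cD k * \<bar>x\<bar> ^ K (fst k) (snd k) \<le> \<bar>a (snd k) x - a (fst k) x\<bar>)"
    by (auto dest!: bchoice)
  hence cD: "\<forall>k\<in>I. cD k > 0"
      "\<forall>k\<in>I. \<forall>\<^sub>F x in nhds 0. cD k * \<bar>x\<bar> ^ K (fst k) (snd k) \<le> \<bar>a (snd k) x - a (fst k) x\<bar>"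
    by auto
  obtain cP where cP: "cP > 0"
      "\<forall>\<^sub>F x in nhds 0. \<forall>y. cP * (\<Prod>j<M. \<bar>y - a j x\<bar> + \<bar>x\<bar> ^ e j) \<le> norm (P x y)"
    using P_lower by blast
  \<comment> \<open>Nodes within half the radius of convergence make \<open>D\<close> below a
    remainder constant independent of x.\<close>
  have small: "\<forall>\<^sub>F x in nhds 0. \<forall>j\<in>{..<M}. \<bar>a j x\<bar> < r / 2"
    using r by (intro branches_eventually_less) simp
  have ev: "\<forall>\<^sub>F x in nhds 0. \<bar>x\<bar> < r \<and> (\<forall>j\<in>{..<M}. \<bar>a j x\<bar> < r / 2) \<and>
      (\<forall>j\<in>{..<M}. norm (Q x (a j x)) \<le> CQ j * \<bar>x\<bar> ^ m j) \<and>
      (\<forall>k\<in>I. cD k * \<bar>x\<bar> ^ K (fst k) (snd k) \<le> \<bar>a (snd k) x - a (fst k) x\<bar>) \<and>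
      (\<forall>y. cP * (\<Prod>j<M. \<bar>y - a j x\<bar> + \<bar>x\<bar> ^ e j) \<le> norm (P x y))"
    using CQ(2) cD(2) \<open>finite I\<close>
    by (intro eventually_conj eventually_nhds_0_abs_less r small eventually_ball_finite cP(2)) auto
  then obtain d where d: "d > 0" "\<And>x. \<bar>x\<bar> < d \<Longrightarrow> \<bar>x\<bar> < r \<and> (\<forall>j\<in>{..<M}. \<bar>a j x\<bar> < r / 2) \<and>
      (\<forall>j\<in>{..<M}. norm (Q x (a j x)) \<le> CQ j * \<bar>x\<bar> ^ m j) \<and>
      (\<forall>k\<in>I. cD k * \<bar>x\<bar> ^ K (fst k) (snd k) \<le> \<bar>a (snd k) x - a (fst k) x\<bar>) \<and>
      (\<forall>y. cP * (\<Prod>j<M. \<bar>y - a j x\<bar> + \<bar>x\<bar> ^ e j) \<le> norm (P x y))"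
    by (auto simp: eventually_nhds_metric dist_real_def)
  \<comment> \<open>Constant of the j-th Lagrange term: the bound for \<open>Q\<close> on the branch
    over the lower bounds for the node differences.\<close>
  define B where "B = (\<lambda>j. CQ j / (\<Prod>i\<in>{..<M} - {j}. cD (i, j)))"
  have B: "B j \<ge> 0" if "j < M" for j
    using CQ(1) cD(1) that
    by (intro less_imp_le) (auto simp: B_def I_def intro!: divide_pos_pos prod_pos)
  define D where "D = (\<Sum>\<^sub>\<infinity>(i,j). norm (c i j) * r ^ (i + j)) / (r / 2) ^ M"
  have D: "D \<ge> 0" unfolding D_def using r by (auto intro!: divide_nonneg_nonneg infsum_nonneg)
  \<comment> \<open>Dividing by \<open>cP\<close> turns the comparison product into the norm of
    \<open>P\<close>.\<close>
  define C where "C = (D + (\<Sum>j<M. B j)) / cP"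
  have C: "C \<ge> 0" unfolding C_def using B D cP by (auto intro!: divide_nonneg_pos add_nonneg_nonneg sum_nonneg)
  have "norm (Q x y / P x y) \<le> C * (1 + (\<Sum>j<M. \<bar>x\<bar> powr s j / (\<bar>y - a j x\<bar> + \<bar>x\<bar> ^ e j)))"
    if x: "x \<noteq> 0" "\<bar>x\<bar> < min d r" and y: "\<bar>y\<bar> < min d r" for x y
  proof -
    have dx: "\<bar>a j x\<bar> < r / 2" "norm (Q x (a j x)) \<le> CQ j * \<bar>x\<bar> ^ m j" if "j < M" for j
      using d(2)[of x] x that by auto
    have dd: "cD (i,j) * \<bar>x\<bar> ^ K i j \<le> \<bar>a j x - a i x\<bar>" "cD (i,j) > 0"
      if "i < M" "j < M" "i \<noteq> j" for i j
      using d(2)[of x] x that cD(1) by (auto simp: I_def)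
    have dP: "cP * (\<Prod>j<M. \<bar>y - a j x\<bar> + \<bar>x\<bar> ^ e j) \<le> norm (P x y)"
      using d(2)[of x] x by auto
    define W where "W = (\<lambda>j. \<bar>y - a j x\<bar> + \<bar>x\<bar> ^ e j)"
    have W: "W j > 0" for j using x by (simp add: W_def add_nonneg_pos)
    define A where "A = (\<lambda>j. complex_of_real (a j x))"
    define b where "b = (\<lambda>j. \<bar>x\<bar> powr s j / W j)"
    have b: "b j \<ge> 0" for j using W[of j] by (simp add: b_def)
    have diff_pos: "0 < \<bar>a j x - a i x\<bar>" if "i < M" "j < M" "i \<noteq> j" for i j
      using dd[OF that] x by (smt (verit) mult_pos_pos zero_less_power abs_ge_zero zero_less_abs_iff)
    have inj: "inj_on A {..<M}"
      using diff_pos by (intro inj_onI) (force simp: A_def)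
    have term_le: "norm (Q x (a j x) * lagrange {..<M} A j (of_real y)) \<le> B j * b j * (\<Prod>j<M. W j)"
      if j: "j < M" for j
    proof -
      have "norm (lagrange {..<M} A j (of_real y)) = (\<Prod>i\<in>{..<M} - {j}. \<bar>y - a i x\<bar> / \<bar>a j x - a i x\<bar>)"
        by (simp add: lagrange_def A_def norm_divide flip: of_real_diff prod_norm)
      also have "\<dots> \<le> (\<Prod>i\<in>{..<M} - {j}. W i / (cD (i,j) * \<bar>x\<bar> ^ K i j))"
        using dd j x by (intro prod_mono conjI frac_le) (auto simp: W_def)
      also have "\<dots> = (\<Prod>i\<in>{..<M} - {j}. W i) / ((\<Prod>i\<in>{..<M} - {j}. cD (i, j)) * (\<Prod>i\<in>{..<M} - {j}. \<bar>x\<bar> ^ K i j))"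
        by (simp add: prod_dividef prod.distrib)
      finally have l: "norm (lagrange {..<M} A j (of_real y)) \<le> \<dots>" .
      have "norm (Q x (a j x) * lagrange {..<M} A j (of_real y))
        \<le> (CQ j * \<bar>x\<bar> ^ m j) * ((\<Prod>i\<in>{..<M} - {j}. W i) /
          ((\<Prod>i\<in>{..<M} - {j}. cD (i, j)) * (\<Prod>i\<in>{..<M} - {j}. \<bar>x\<bar> ^ K i j)))"
        unfolding norm_mult using CQ(1) j
        by (intro mult_mono dx l) (auto intro!: mult_nonneg_nonneg intro: less_imp_le)
      also have "\<dots> = B j * (\<bar>x\<bar> ^ m j / (\<Prod>i\<in>{..<M} - {j}. \<bar>x\<bar> ^ K i j)) * (\<Prod>i\<in>{..<M} - {j}. W i)"
        by (simp add: B_def)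
      also have "\<bar>x\<bar> ^ m j / (\<Prod>i\<in>{..<M} - {j}. \<bar>x\<bar> ^ K i j) = \<bar>x\<bar> powr s j"
        using x by (simp add: s_def powr_diff powr_realpow powr_sum flip: power_sum of_nat_sum)
      also have "(\<Prod>i\<in>{..<M} - {j}. W i) = (\<Prod>i<M. W i) / W j"
        using j W[of j] by (subst prod.remove[of "{..<M}" j]) auto
      finally show ?thesis by (simp add: b_def)
    qed
    have "norm (Q x y - (\<Sum>j<M. Q x (a j x) * lagrange {..<M} A j (of_real y)))
        \<le> D * norm (\<Prod>i<M. complex_of_real y - A i)"
      using lagrange_remainder_ps2[OF r(2), of "{..<M}" A "r / 2" "of_real x" "of_real y"] inj dx(1) r x y
      by (force simp: A_def Q_def D_def less_imp_le)
    also have "norm (\<Prod>i<M. complex_of_real y - A i) = (\<Prod>i<M. \<bar>y - a i x\<bar>)"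
      by (simp add: A_def flip: of_real_diff prod_norm)
    also have "D * \<dots> \<le> D * (\<Prod>i<M. W i)"
      using D by (intro mult_left_mono prod_mono) (auto simp: W_def)
    finally have "norm (Q x y - (\<Sum>j<M. Q x (a j x) * lagrange {..<M} A j (of_real y))) \<le> D * (\<Prod>i<M. W i)" .
    moreover have "norm (\<Sum>j<M. Q x (a j x) * lagrange {..<M} A j (of_real y)) \<le> (\<Sum>j<M. B j * b j * (\<Prod>j<M. W j))"
      by (intro sum_norm_le term_le) auto
    ultimately have "norm (Q x y) \<le> D * (\<Prod>i<M. W i) + (\<Sum>j<M. B j * b j * (\<Prod>j<M. W j))"
      using norm_triangle_sub[of "Q x y" "\<Sum>j<M. Q x (a j x) * lagrange {..<M} A j (of_real y)"] by linarith
    also have "\<dots> = (D * 1 + (\<Sum>j<M. B j * b j)) * (\<Prod>i<M. W i)"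
      by (simp add: sum_distrib_right distrib_right)
    \<comment> \<open>A crude factorization that separates all constants from the part depending on
      x and y.\<close>
    also have "\<dots> \<le> ((D + (\<Sum>j<M. B j)) * (1 + (\<Sum>j<M. b j))) * (\<Prod>i<M. W i)"
    proof (intro mult_right_mono prod_nonneg)
      have "(\<Sum>j<M. B j * b j) \<le> (\<Sum>j<M. B j * (\<Sum>j<M. b j))"
        using B b by (intro sum_mono mult_left_mono member_le_sum) auto
      also have "\<dots> = (\<Sum>j<M. B j) * (\<Sum>j<M. b j)" by (simp add: sum_distrib_right)
      finally have "(\<Sum>j<M. B j * b j) \<le> (\<Sum>j<M. B j) * (\<Sum>j<M. b j)" .
      moreover have "0 \<le> D * (\<Sum>j<M. b j)" "0 \<le> (\<Sum>j<M. B j)"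
        using D B b by (auto intro!: mult_nonneg_nonneg sum_nonneg)
      ultimately show "D * 1 + (\<Sum>j<M. B j * b j) \<le> (D + (\<Sum>j<M. B j)) * (1 + (\<Sum>j<M. b j))"
        by (simp add: algebra_simps)
    qed (use W less_imp_le in blast)
    also have "\<dots> = C * (1 + (\<Sum>j<M. b j)) * (cP * (\<Prod>i<M. W i))"
      using cP(1) by (simp add: C_def)
    also have "\<dots> \<le> C * (1 + (\<Sum>j<M. b j)) * norm (P x y)"
      using C b dP by (intro mult_left_mono) (auto simp: W_def intro!: mult_nonneg_nonneg add_nonneg_nonneg sum_nonneg)
    finally have fin: "norm (Q x y) \<le> C * (1 + (\<Sum>j<M. b j)) * norm (P x y)" .
    have "0 < cP * (\<Prod>i<M. W i)" using cP W by (auto intro!: mult_pos_pos prod_pos)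
    hence "norm (P x y) > 0" using dP unfolding W_def by linarith
    with fin show ?thesis
      by (simp add: norm_divide pos_divide_le_eq b_def W_def)
  qed
  thus ?thesis using C d(1) r(1)
    unfolding Q_def by (intro exI[of _ C] conjI exI[of _ "min d r"]) auto
qed

text \<open>The p-th power of the pointwise bound is integrated first in y, by the kernel estimate,
  and then in x. The hypothesis on \<open>m j\<close> is the one that leaves a power of x above
  -1.\<close>

lemma Lp_loc_quotient_if_vanishes:
  assumes c: "conv_ps2 c" and p: "1 \<le> p"
    and m: "\<And>j. j < M \<Longrightarrow> vanishes_to_order (\<lambda>x. eval_ps2 c (of_real x) (of_real (a j x))) (m j)"
    and mp: "\<And>j. j < M \<Longrightarrow> p * (real (m j) - (\<Sum>i<M. real (K i j))) + e j > -1"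
  shows "Lp_loc p (\<lambda>z. eval_ps2 c (of_real (fst z)) (of_real (snd z)) / P (fst z) (snd z))"
proof -
  define f where "f = (\<lambda>z. eval_ps2 c (of_real (fst z)) (of_real (snd z)) / P (fst z) (snd z))"
  define s where "s = (\<lambda>j. real (m j) - (\<Sum>i\<in>{..<M} - {j}. real (K i j)))"
  define b where "b = (\<lambda>j x y. \<bar>x\<bar> powr s j / (\<bar>y - a j x\<bar> + \<bar>x\<bar> ^ e j))"
  have b: "b j x y \<ge> 0" for j x y by (auto simp: b_def)
  obtain r where r: "r > 0" "(\<lambda>(i,j). norm (c i j) * r ^ (i + j)) summable_on UNIV"
    using c by (rule conv_ps2_radius)
  obtain C d0 where C: "C \<ge> 0" "d0 > 0" "\<And>x y. x \<noteq> 0 \<Longrightarrow> \<bar>x\<bar> < d0 \<Longrightarrow> \<bar>y\<bar> < d0 \<Longrightarrow>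
      norm (f (x, y)) \<le> C * (1 + (\<Sum>j<M. b j x y))"
    using quotient_bound[OF c m] unfolding f_def s_def b_def by force
  define d where "d = min d0 r"
  have d: "d > 0" "d \<le> d0" "d \<le> r" using C r by (auto simp: d_def)
  \<comment> \<open>The kernel estimate needs the branches inside the y-interval, so the x-interval
    is shortened to half-width \<open>h\<close> after \<open>d\<close> is fixed.\<close>
  have "\<forall>\<^sub>F x in nhds 0. \<forall>j\<in>{..<M}. \<bar>a j x\<bar> < d"
    using d(1) by (rule branches_eventually_less)
  then obtain d1 where d1: "d1 > 0" "\<And>x j. \<bar>x\<bar> < d1 \<Longrightarrow> j < M \<Longrightarrow> \<bar>a j x\<bar> < d"
    by (auto simp: eventually_nhds_metric dist_real_def)
  define h where "h = min d d1"
  have h: "h > 0" "h \<le> d" "h \<le> d1" using d d1 by (auto simp: h_def)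
  have "\<forall>j\<in>{..<M}. \<exists>\<beta> I. -1 < \<beta> \<and> I < (\<infinity>::ennreal) \<and> (\<forall>x a. x \<noteq> 0 \<longrightarrow> \<bar>a\<bar> < d \<longrightarrow>
      (\<integral>\<^sup>+y\<in>{-d<..<d}. ennreal ((\<bar>x\<bar> powr s j / (\<bar>y - a\<bar> + \<bar>x\<bar> ^ e j)) powr p) \<partial>lborel)
        \<le> I * ennreal (\<bar>x\<bar> powr \<beta>))"
  proof
    fix j assume j: "j \<in> {..<M}"
    \<comment> \<open>The diagonal entry \<open>K j j = e j\<close> accounts for the difference
      between \<open>p * s j - e j * (p - 1)\<close> and the hypothesis, which are equal.\<close>
    have "(\<Sum>i<M. real (K i j)) = e j + (\<Sum>i\<in>{..<M} - {j}. real (K i j))"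
      using j K_diag by (simp add: sum.remove)
    hence "p * s j - e j * (p - 1) > -1"
      using mp[of j] j by (simp add: s_def algebra_simps)
    from nn_integral_kernel_le[OF p d(1) this]
    show "\<exists>\<beta> I. -1 < \<beta> \<and> I < (\<infinity>::ennreal) \<and> (\<forall>x a. x \<noteq> 0 \<longrightarrow> \<bar>a\<bar> < d \<longrightarrow>
      (\<integral>\<^sup>+y\<in>{-d<..<d}. ennreal ((\<bar>x\<bar> powr s j / (\<bar>y - a\<bar> + \<bar>x\<bar> ^ e j)) powr p) \<partial>lborel)
        \<le> I * ennreal (\<bar>x\<bar> powr \<beta>))" .
  qed
  then obtain \<beta> where "\<forall>j\<in>{..<M}. \<exists>I. -1 < \<beta> j \<and> I < (\<infinity>::ennreal) \<and> (\<forall>x a. x \<noteq> 0 \<longrightarrow> \<bar>a\<bar> < d \<longrightarrow>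
      (\<integral>\<^sup>+y\<in>{-d<..<d}. ennreal ((\<bar>x\<bar> powr s j / (\<bar>y - a\<bar> + \<bar>x\<bar> ^ e j)) powr p) \<partial>lborel)
        \<le> I * ennreal (\<bar>x\<bar> powr \<beta> j))"
    by (rule bchoice[THEN exE])
  then obtain I where I: "\<forall>j\<in>{..<M}. -1 < \<beta> j \<and> I j < (\<infinity>::ennreal) \<and> (\<forall>x a. x \<noteq> 0 \<longrightarrow> \<bar>a\<bar> < d \<longrightarrow>
      (\<integral>\<^sup>+y\<in>{-d<..<d}. ennreal ((\<bar>x\<bar> powr s j / (\<bar>y - a\<bar> + \<bar>x\<bar> ^ e j)) powr p) \<partial>lborel)
        \<le> I j * ennreal (\<bar>x\<bar> powr \<beta> j))"
    by (rule bchoice[THEN exE])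
  define U where "U = {-h<..<h} \<times> {-d<..<d}"
  have U: "open U" "(0,0) \<in> U" using h d by (auto simp: U_def intro!: open_Times)
  have U_meas: "U \<in> sets borel" using U(1) by simp
  have "(\<lambda>z. indicator U z *\<^sub>R eval_ps2 c (of_real (fst z)) (of_real (snd z)) / P (fst z) (snd z))
      \<in> borel_measurable borel"
    using h d by (intro borel_measurable_divide eval_ps2_indicator_measurable[OF r(2)] P_measurable U_meas)
      (auto simp: U_def)
  hence meas: "(\<lambda>z. indicator U z *\<^sub>R f z) \<in> borel_measurable borel"
    by (simp add: f_def scaleR_conv_of_real)
  define g where "g = (\<lambda>z. ennreal (norm (f z) powr p) * indicator U z)"
  \<comment> \<open>Measurability is available only for the quotient cut off outside
    \<open>U\<close>.\<close>
  have g_eq: "g = (\<lambda>z. ennreal (norm (indicator U z *\<^sub>R f z) powr p) * indicator U z)"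
    by (auto simp: g_def indicator_def fun_eq_iff)
  have g_meas: "g \<in> borel_measurable borel"
    unfolding g_eq using meas U_meas by measurable
  define C' where "C' = (C * (1 + real M)) powr p"
  have C': "C' \<ge> 0" by (simp add: C'_def)
  have inner: "(\<integral>\<^sup>+y. g (x, y) \<partial>lborel)
      \<le> ennreal C' * (ennreal (2 * d) + (\<Sum>j<M. I j * ennreal (\<bar>x\<bar> powr \<beta> j))) * indicator {-h<..<h} x"
    if x: "x \<noteq> 0" for x
  proof (cases "x \<in> {-h<..<h}")
    case True
    hence ax: "\<bar>a j x\<bar> < d" if "j < M" for j using d1(2)[of x j] h that by auto
    have bm [measurable]: "(\<lambda>y. b j x y) \<in> borel_measurable borel" for j
      unfolding b_def by measurable
    have "(\<integral>\<^sup>+y. g (x, y) \<partial>lborel)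
        \<le> (\<integral>\<^sup>+y. ennreal C' * (indicator {-d<..<d} y + (\<Sum>j<M. ennreal (b j x y powr p) * indicator {-d<..<d} y)) \<partial>lborel)"
    proof (rule nn_integral_mono)
      fix y :: real
      show "g (x, y) \<le> ennreal C' * (indicator {-d<..<d} y + (\<Sum>j<M. ennreal (b j x y powr p) * indicator {-d<..<d} y))"
      proof (cases "y \<in> {-d<..<d}")
        case y: True
        have "norm (f (x,y)) \<le> C * (1 + (\<Sum>j<M. b j x y))"
          using C(3)[of x y] x y True h d by auto
        hence "norm (f (x,y)) powr p \<le> (C * (1 + (\<Sum>j<M. b j x y))) powr p"
          using p by (intro powr_mono2) auto
        also have "\<dots> = C powr p * (1 + (\<Sum>j<M. b j x y)) powr p"
          using C b by (intro powr_mult)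
        also have "\<dots> \<le> C powr p * ((1 + real M) powr p * (1 + (\<Sum>j<M. b j x y powr p)))"
          using one_plus_sum_powr_le[of "{..<M}" "\<lambda>j. b j x y" p] b p by (intro mult_left_mono) auto
        also have "\<dots> = C' * (1 + (\<Sum>j<M. b j x y powr p))"
          using C by (simp add: C'_def powr_mult)
        finally have "ennreal (norm (f (x,y)) powr p) \<le> ennreal (C' * (1 + (\<Sum>j<M. b j x y powr p)))"
          by (rule ennreal_leI)
        also have "\<dots> = ennreal C' * (1 + (\<Sum>j<M. ennreal (b j x y powr p)))"
          using C' by (simp add: ennreal_mult sum_nonneg ennreal_plus)
        finally show ?thesis using y True by (simp add: g_def U_def)
      qed (auto simp: g_def U_def)
    qed
    also have "\<dots> = ennreal C' * ((\<integral>\<^sup>+y. indicator {-d<..<d} y \<partial>lborel)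
        + (\<Sum>j<M. \<integral>\<^sup>+y. ennreal (b j x y powr p) * indicator {-d<..<d} y \<partial>lborel))"
      by (subst nn_integral_cmult, measurable, subst nn_integral_add, measurable, subst nn_integral_sum) auto
    also have "(\<integral>\<^sup>+y. indicator {-d<..<d} y \<partial>lborel) = ennreal (2 * d)"
      using d by simp
    also have "ennreal C' * (ennreal (2 * d) + (\<Sum>j<M. \<integral>\<^sup>+y. ennreal (b j x y powr p) * indicator {-d<..<d} y \<partial>lborel))
        \<le> ennreal C' * (ennreal (2 * d) + (\<Sum>j<M. I j * ennreal (\<bar>x\<bar> powr \<beta> j)))"
      using I x ax unfolding b_def by (intro mult_left_mono add_left_mono sum_mono) auto
    finally show ?thesis using True by simp
  qed (auto simp: g_def U_def)
  have "(\<integral>\<^sup>+z\<in>U. ennreal (norm (f z) powr p) \<partial>lborel) = integral\<^sup>N (lborel \<Otimes>\<^sub>M lborel) g"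
    by (simp add: g_def lborel_prod)
  also have "\<dots> = (\<integral>\<^sup>+x. \<integral>\<^sup>+y. g (x, y) \<partial>lborel \<partial>lborel)"
    using g_meas by (subst lborel.nn_integral_fst) (simp_all add: lborel_prod)
  also have "\<dots> \<le> (\<integral>\<^sup>+x. ennreal C' * (ennreal (2 * d) + (\<Sum>j<M. I j * ennreal (\<bar>x\<bar> powr \<beta> j))) * indicator {-h<..<h} x \<partial>lborel)"
    \<comment> \<open>The line \<open>x = 0\<close>, where the quotient bound says nothing, is a
      null set.\<close>
    by (rule nn_integral_mono_AE, rule eventually_mono[OF AE_lborel_singleton[of 0]]) (rule inner)
  also have "\<dots> = (\<integral>\<^sup>+x. ennreal C' * (ennreal (2 * d) * indicator {-h<..<h} x
      + (\<Sum>j<M. I j * (ennreal (\<bar>x\<bar> powr \<beta> j) * indicator {-h<..<h} x))) \<partial>lborel)"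
    by (intro nn_integral_cong) (simp add: indicator_def)
  also have "\<dots> = ennreal C' * (ennreal (2 * d) * ennreal (2 * h)
      + (\<Sum>j<M. I j * (\<integral>\<^sup>+x\<in>{-h<..<h}. ennreal (\<bar>x\<bar> powr \<beta> j) \<partial>lborel)))"
    using h by (subst nn_integral_cmult, measurable, subst nn_integral_add, measurable,
        subst nn_integral_sum, measurable) (simp add: nn_integral_cmult nn_integral_cmult_indicator)
  also have "\<dots> < \<infinity>"
    using I h nn_integral_abs_powr_finite[of _ h]
    by (auto simp: ennreal_mult_less_top)
  finally have "(\<integral>\<^sup>+z\<in>U. ennreal (norm (f z) powr p) \<partial>lborel) < \<infinity>" .
  moreover have "set_borel_measurable lborel U f"
    using meas by (simp add: set_borel_measurable_def)
  ultimately show ?thesis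
    using U unfolding Lp_loc_def f_def by blast
qed

section \<open>Necessity of the order conditions\<close>

text \<open>Interpolating \<open>Q(x, \<cdot>)\<close> at \<open>a + h, \<dots>, a + N h\<close> and evaluating at \<open>a\<close> costs only weights
  independent of \<open>h\<close>, so \<open>Q(x, a)\<close> cannot be much larger than all of the values at the nodes.\<close>

lemma quotient_large_near_branch:
  assumes c: "conv_ps2 c" and j: "j < M" and \<rho>: "\<rho> > 0" and c0: "c0 > 0"
    and low: "\<forall>\<^sub>F x in nhds 0. c0 * \<bar>x\<bar> ^ k \<le> norm (eval_ps2 c (of_real x) (of_real (a j x)))"
  shows "\<exists>c1>0. \<exists>d>0. \<forall>x \<theta>. 0 < x \<longrightarrow> x < d \<longrightarrow> 0 < \<theta> \<longrightarrow> \<theta> < 1 \<longrightarrow>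
    (\<exists>i\<in>{1..Suc k}. \<bar>a j x + (real i * x ^ e j) * \<theta>\<bar> < \<rho> \<and>
      c1 * x powr (real k - (\<Sum>i<M. real (K i j)))
        \<le> norm (eval_ps2 c (of_real x) (of_real (a j x + (real i * x ^ e j) * \<theta>))
            / P x (a j x + (real i * x ^ e j) * \<theta>)))"
proof -
  define Q where "Q = (\<lambda>x y. eval_ps2 c (of_real x) (of_real y))"
  \<comment> \<open>With k+1 nodes at spacing at most x the remainder is O(x^(k+1)), of smaller
    order than the lower bound \<open>c0 * x ^ k\<close>.\<close>
  define N where "N = Suc k"
  obtain r where r: "r > 0" "(\<lambda>(i,j). norm (c i j) * r ^ (i + j)) summable_on UNIV"
    using c by (rule conv_ps2_radius)
  define D where "D = (\<Sum>\<^sub>\<infinity>(i,j). norm (c i j) * r ^ (i + j)) / (r / 2) ^ N"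
  have D: "D \<ge> 0" unfolding D_def using r by (auto intro!: divide_nonneg_nonneg infsum_nonneg)
  \<comment> \<open>Moduli of the Lagrange basis polynomials of the nodes a + i h at the point a;
    the step h cancels.\<close>
  define w where "w = (\<lambda>i. \<Prod>l\<in>{1..N} - {i}. real l / \<bar>real i - real l\<bar>)"
  define ws where "ws = 1 + (\<Sum>i=1..N. w i)"
  have w: "w i \<ge> 0" for i by (auto simp: w_def intro!: prod_nonneg)
  have w_le: "w i \<le> ws" if "i \<in> {1..N}" for i
    using member_le_sum[OF that, of w] w by (simp add: ws_def)
  have ws: "ws > 0" unfolding ws_def using w by (simp add: add_pos_nonneg sum_nonneg)
  obtain Ca where Ca: "Ca > 0" "\<forall>\<^sub>F x in nhds 0. \<bar>a j x\<bar> \<le> Ca * \<bar>x\<bar>"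
    using a_vanishes[OF j] by (auto simp: vanishes_to_order_def eventually_nhds_metric dist_real_def)
  obtain CP where CP: "CP > 0"
      "\<forall>\<^sub>F x in nhds 0. \<forall>y. norm (P x y) \<le> CP * (\<Prod>j<M. \<bar>y - a j x\<bar> + \<bar>x\<bar> ^ e j)"
    using P_upper by blast
  obtain cP where cP: "cP > 0"
      "\<forall>\<^sub>F x in nhds 0. \<forall>y. cP * (\<Prod>j<M. \<bar>y - a j x\<bar> + \<bar>x\<bar> ^ e j) \<le> norm (P x y)"
    using P_lower by blast
  have "\<forall>l\<in>{..<M}. \<exists>C. C \<ge> 0 \<and> (\<forall>\<^sub>F x in nhds 0. \<bar>a j x - a l x\<bar> \<le> C * \<bar>x\<bar> ^ K l j)"
  proof
    fix l assume l: "l \<in> {..<M}"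
    show "\<exists>C. C \<ge> 0 \<and> (\<forall>\<^sub>F x in nhds 0. \<bar>a j x - a l x\<bar> \<le> C * \<bar>x\<bar> ^ K l j)"
    proof (cases "l = j")
      case False
      hence "vanishes_to_order (\<lambda>x. a j x - a l x) (K l j)" using a_diff_upper l j by simp
      then obtain C where "C > 0" "\<forall>\<^sub>F x in nhds 0. \<bar>a j x - a l x\<bar> \<le> C * \<bar>x\<bar> ^ K l j"
        by (auto simp: vanishes_to_order_def eventually_nhds_metric dist_real_def)
      thus ?thesis by (intro exI[of _ C]) auto
    qed (auto intro!: exI[of _ 0])
  qed
  from bchoice[OF this] obtain Cd where Cd: "\<forall>l\<in>{..<M}. Cd l \<ge> 0"
      "\<forall>l\<in>{..<M}. \<forall>\<^sub>F x in nhds 0. \<bar>a j x - a l x\<bar> \<le> Cd l * \<bar>x\<bar> ^ K l j"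
    by auto
  \<comment> \<open>In order, the entries make powers of x decreasing in the exponent, keep x in the
    domain of convergence, keep the nodes within half the radius, keep them within
    \<open>\<rho>\<close>, and make the remainder at most half of \<open>c0 * x ^ k\<close>.\<close>
  define \<mu> where "\<mu> = Min {1, r, r / 2 / (Ca + N), \<rho> / (Ca + N), c0 / (2 * (D * fact N + 1))}"
  have \<mu>: "\<mu> > 0" "\<mu> \<le> 1" "\<mu> \<le> r" "\<mu> \<le> r / 2 / (Ca + N)" "\<mu> \<le> \<rho> / (Ca + N)"
      "\<mu> \<le> c0 / (2 * (D * fact N + 1))"
    using r Ca \<rho> c0 D by (auto simp: \<mu>_def intro!: divide_pos_pos add_pos_nonneg add_nonneg_pos mult_pos_pos)
  have "\<forall>\<^sub>F x in nhds 0. \<bar>x\<bar> < \<mu> \<and> \<bar>a j x\<bar> \<le> Ca * \<bar>x\<bar> \<and> c0 * \<bar>x\<bar> ^ k \<le> norm (Q x (a j x)) \<and>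
      (\<forall>y. norm (P x y) \<le> CP * (\<Prod>j<M. \<bar>y - a j x\<bar> + \<bar>x\<bar> ^ e j)) \<and>
      (\<forall>y. cP * (\<Prod>j<M. \<bar>y - a j x\<bar> + \<bar>x\<bar> ^ e j) \<le> norm (P x y)) \<and>
      (\<forall>l\<in>{..<M}. \<bar>a j x - a l x\<bar> \<le> Cd l * \<bar>x\<bar> ^ K l j)"
    using Cd(2) low
    by (intro eventually_conj eventually_nhds_0_abs_less \<mu>(1) Ca(2) CP(2) cP(2) eventually_ball_finite)
       (auto simp: Q_def)
  then obtain d where d: "d > 0" "\<And>x. \<bar>x\<bar> < d \<Longrightarrow>
      \<bar>x\<bar> < \<mu> \<and> \<bar>a j x\<bar> \<le> Ca * \<bar>x\<bar> \<and> c0 * \<bar>x\<bar> ^ k \<le> norm (Q x (a j x)) \<and>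
      (\<forall>y. norm (P x y) \<le> CP * (\<Prod>j<M. \<bar>y - a j x\<bar> + \<bar>x\<bar> ^ e j)) \<and>
      (\<forall>y. cP * (\<Prod>j<M. \<bar>y - a j x\<bar> + \<bar>x\<bar> ^ e j) \<le> norm (P x y)) \<and>
      (\<forall>l\<in>{..<M}. \<bar>a j x - a l x\<bar> \<le> Cd l * \<bar>x\<bar> ^ K l j)"
    by (auto simp: eventually_nhds_metric dist_real_def)
  \<comment> \<open>At a node, the l-th factor of the comparison product is at most
    \<open>(N + Cd l + 1) * x ^ K l j\<close>: the node offset, the branch difference and
    \<open>x ^ e l\<close> contribute one summand each, since \<open>K l j\<close> is at most
    \<open>e j\<close> and \<open>e l\<close>.\<close>
  define C2 where "C2 = CP * (\<Prod>l<M. real N + Cd l + 1)"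
  have C2: "C2 > 0" unfolding C2_def using CP Cd(1)
    by (auto intro!: mult_pos_pos prod_pos add_nonneg_pos add_nonneg_nonneg)
  \<comment> \<open>If all \<open>N\<close> node values were below \<open>c2 * x ^ k\<close>, their
    sum with weights at most \<open>ws\<close> would stay below
    \<open>c0 / 2 * x ^ k\<close>.\<close>
  define c2 where "c2 = c0 / (2 * ws * N)"
  have c2: "c2 > 0" using c0 ws by (simp add: c2_def N_def)
  define c1 where "c1 = c2 / C2"
  have c1: "c1 > 0" using c2 C2 by (simp add: c1_def)
  have "\<exists>i\<in>{1..N}. \<bar>a j x + (real i * x ^ e j) * \<theta>\<bar> < \<rho> \<and>
      c1 * x powr (real k - (\<Sum>i<M. real (K i j)))
        \<le> norm (Q x (a j x + (real i * x ^ e j) * \<theta>) / P x (a j x + (real i * x ^ e j) * \<theta>))"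
    if x: "0 < x" "x < d" and \<theta>: "0 < \<theta>" "\<theta> < 1" for x \<theta>
  proof -
    have absx: "\<bar>x\<bar> = x" using x by simp
    note dx = d(2)[of x, unfolded absx, OF x(2)]
    define h where "h = x ^ e j * \<theta>"
    define y where "y = (\<lambda>i. a j x + (real i * x ^ e j) * \<theta>)"
    have y_eq: "y i = a j x + real i * h" for i by (simp add: y_def h_def)
    have x1: "x \<le> 1" using dx \<mu> by linarith
    have h: "0 < h" "h \<le> x ^ e j" using x \<theta> by (auto simp: h_def mult_left_le)
    have "x ^ e j \<le> x ^ 1" using e_pos[OF j] x x1 by (intro power_decreasing) auto
    hence hx: "h \<le> x" using h by simp
    have ih: "real i * h \<le> N * h" if "i \<in> {1..N}" for i
      using that h by (intro mult_right_mono) auto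
    have y_le: "\<bar>y i\<bar> \<le> (Ca + N) * x" if "i \<in> {1..N}" for i
    proof -
      have "\<bar>y i\<bar> \<le> \<bar>a j x\<bar> + real i * h" using h by (simp add: y_eq abs_mult abs_triangle_ineq[THEN order_trans])
      also have "\<dots> \<le> Ca * x + N * h" using dx ih[OF that] by linarith
      also have "\<dots> \<le> Ca * x + N * x" using hx by (intro add_left_mono mult_left_mono) auto
      finally show ?thesis by (simp add: algebra_simps)
    qed
    have CaN: "Ca + N > 0" using Ca by (simp add: N_def)
    have x\<mu>: "x < \<mu>" using dx by simp
    have "(Ca + N) * x \<le> r / 2"
      using order_trans[OF less_imp_le[OF x\<mu>] \<mu>(4)] unfolding pos_le_divide_eq[OF CaN]
      by (simp only: mult.commute)
    hence y_r: "\<bar>y i\<bar> \<le> r / 2" if "i \<in> {1..N}" for i using y_le[OF that] by linarith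
    have "(Ca + N) * x < \<rho>"
      using mult_strict_left_mono[of x "\<rho> / (Ca + N)" "Ca + N"] x\<mu> \<mu>(5) CaN by simp
    hence y_\<rho>: "\<bar>y i\<bar> < \<rho>" if "i \<in> {1..N}" for i using y_le[OF that] by linarith
    have a_r: "\<bar>a j x\<bar> \<le> r"
    proof -
      have "Ca * x \<le> (Ca + N) * x" using x by (intro mult_right_mono) auto
      thus ?thesis using dx \<open>(Ca + N) * x \<le> r / 2\<close> r by linarith
    qed
    define A where "A = (\<lambda>i. complex_of_real (y i))"
    have inj: "inj_on A {1..N}" using h by (auto simp: inj_on_def A_def y_eq)
    have lag: "norm (lagrange {1..N} A i (of_real (a j x))) = w i" for i
    proof -
      have "norm ((of_real (a j x) - A l) / (A i - A l)) = real l / \<bar>real i - real l\<bar>" for l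
      proof -
        have "norm ((of_real (a j x) - A l) / (A i - A l)) = \<bar>a j x - y l\<bar> / \<bar>y i - y l\<bar>"
          by (simp add: A_def norm_divide flip: of_real_diff)
        also have "a j x - y l = - (real l * h)" by (simp add: y_eq)
        also have "y i - y l = (real i - real l) * h" by (simp add: y_eq algebra_simps)
        finally show ?thesis using h by (simp add: abs_mult)
      qed
      thus ?thesis by (simp add: lagrange_def w_def flip: prod_norm)
    qed
    have "norm (Q x (a j x) - (\<Sum>i=1..N. Q x (y i) * lagrange {1..N} A i (of_real (a j x))))
        \<le> D * norm (\<Prod>i=1..N. complex_of_real (a j x) - A i)"
      using lagrange_remainder_ps2[OF r(2), of "{1..N}" A "r / 2" "of_real x" "of_real (a j x)"]
        inj y_r r x x\<mu> \<mu>(3) a_r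
      by (simp add: A_def Q_def D_def)
    also have "norm (\<Prod>i=1..N. complex_of_real (a j x) - A i) = (\<Prod>i=1..N. real i * h)"
    proof -
      have "norm (complex_of_real (a j x) - A i) = real i * h" for i
        using h by (simp add: A_def y_eq norm_mult)
      thus ?thesis by (simp flip: prod_norm)
    qed
    also have "\<dots> = fact N * h ^ N" by (simp add: prod.distrib fact_prod)
    also have "h ^ N \<le> x ^ N" using h hx by (intro power_mono) auto
    hence "D * (fact N * h ^ N) \<le> D * (fact N * x ^ N)" using D by (intro mult_left_mono) auto
    finally have rem: "norm (Q x (a j x) - (\<Sum>i=1..N. Q x (y i) * lagrange {1..N} A i (of_real (a j x))))
        \<le> D * fact N * x ^ N" by (simp add: mult.assoc)
    have "D * fact N * x \<le> (D * fact N + 1) * x" using x by (intro mult_right_mono) auto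
    also have "\<dots> \<le> (D * fact N + 1) * (c0 / (2 * (D * fact N + 1)))"
      using x\<mu> \<mu>(6) D by (intro mult_left_mono) auto
    also have "\<dots> = c0 / 2"
    proof -
      have "D * fact N + 1 > 0" using D by (intro add_nonneg_pos) auto
      thus ?thesis by (simp add: field_simps)
    qed
    finally have "D * fact N * x * x ^ k \<le> c0 / 2 * x ^ k" using x by (intro mult_right_mono) auto
    hence rem2: "D * fact N * x ^ N \<le> c0 / 2 * x ^ k" by (simp add: N_def mult_ac)
    have "norm (\<Sum>i=1..N. Q x (y i) * lagrange {1..N} A i (of_real (a j x))) \<le> (\<Sum>i=1..N. norm (Q x (y i)) * ws)"
      unfolding norm_mult by (intro sum_norm_le, unfold norm_mult lag) (intro mult_left_mono w_le norm_ge_zero)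
    hence "c0 / 2 * x ^ k \<le> (\<Sum>i=1..N. norm (Q x (y i)) * ws)"
      using norm_triangle_sub[of "Q x (a j x)" "\<Sum>i=1..N. Q x (y i) * lagrange {1..N} A i (of_real (a j x))"]
        rem rem2 dx by linarith
    hence sum_ge: "c0 / 2 * x ^ k \<le> (\<Sum>i=1..N. norm (Q x (y i))) * ws"
      by (simp add: sum_distrib_right)
    have "\<exists>i\<in>{1..N}. c2 * x ^ k \<le> norm (Q x (y i))"
    proof (rule ccontr)
      assume "\<not> ?thesis"
      hence "(\<Sum>i=1..N. norm (Q x (y i))) < (\<Sum>i=1..N. c2 * x ^ k)"
        by (intro sum_strict_mono) (auto simp: N_def not_le)
      also have "\<dots> = N * (c2 * x ^ k)" by simp
      finally have "(\<Sum>i=1..N. norm (Q x (y i))) * ws < N * (c2 * x ^ k) * ws"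
        using ws by (intro mult_strict_right_mono)
      also have "\<dots> = c0 / 2 * x ^ k" using ws by (simp add: c2_def N_def)
      finally show False using sum_ge by simp
    qed
    then obtain i where i: "i \<in> {1..N}" "c2 * x ^ k \<le> norm (Q x (y i))" by blast
    have "norm (P x (y i)) \<le> CP * (\<Prod>l<M. \<bar>y i - a l x\<bar> + x ^ e l)"
      using dx by blast
    also have "(\<Prod>l<M. \<bar>y i - a l x\<bar> + x ^ e l) \<le> (\<Prod>l<M. (N + Cd l + 1) * x ^ K l j)"
    proof (intro prod_mono conjI)
      fix l assume l: "l \<in> {..<M}"
      have e1: "x ^ e l \<le> x ^ K l j" "x ^ e j \<le> x ^ K l j"
        using K_le[of l j] l j x x1 by (auto intro!: power_decreasing)
      have "\<bar>y i - a l x\<bar> \<le> \<bar>a j x - a l x\<bar> + N * h"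
        using ih[OF i(1)] h unfolding y_eq
        by (smt (verit) mult_nonneg_nonneg of_nat_0_le_iff)
      also have "N * h \<le> N * x ^ K l j" using h e1 by (intro mult_left_mono) auto
      also have "\<bar>a j x - a l x\<bar> \<le> Cd l * x ^ K l j" using dx l by blast
      finally show "\<bar>y i - a l x\<bar> + x ^ e l \<le> (N + Cd l + 1) * x ^ K l j"
        using e1 by (simp add: algebra_simps)
      show "0 \<le> \<bar>y i - a l x\<bar> + x ^ e l" using x by simp
    qed
    also have "\<dots> = (\<Prod>l<M. real N + Cd l + 1) * x ^ (\<Sum>l<M. K l j)"
      by (simp add: prod.distrib power_sum)
    finally have P_le: "norm (P x (y i)) \<le> C2 * x ^ (\<Sum>l<M. K l j)"
      using CP by (simp add: C2_def mult.assoc)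
    \<comment> \<open>Strict positivity of \<open>P\<close> at the node is needed to pass from its
      upper bound to a lower bound for the quotient.\<close>
    have "0 < cP * (\<Prod>l<M. \<bar>y i - a l x\<bar> + x ^ e l)"
      using cP x by (intro mult_pos_pos prod_pos) (auto intro!: add_nonneg_pos)
    also have "\<dots> \<le> norm (P x (y i))" using dx by blast
    finally have P_pos: "norm (P x (y i)) > 0" .
    have "c1 * x powr (real k - (\<Sum>i<M. real (K i j))) = c2 * x ^ k / (C2 * x ^ (\<Sum>l<M. K l j))"
      using x by (simp add: c1_def powr_diff powr_realpow flip: of_nat_sum)
    also have "\<dots> \<le> norm (Q x (y i)) / norm (P x (y i))"
      using i(2) P_le P_pos c2 x by (intro frac_le) auto
    finally show ?thesis
      using i(1) y_\<rho>[OF i(1)] unfolding y_def norm_divide by blast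
  qed
  thus ?thesis using c1 d(1) unfolding Q_def N_def by blast
qed

text \<open>If the order were some \<open>k < m\<close>, the quotient would be large at some node
  for every \<theta>. Averaging over \<theta> and changing variables to y shows that each vertical
  slice integral is at least a constant over x, which is not integrable at 0.\<close>

lemma vanishes_if_Lp_loc_quotient:
  assumes c: "conv_ps2 c" and p: "1 \<le> p" and j: "j < M"
    and Lp: "Lp_loc p (\<lambda>z. eval_ps2 c (of_real (fst z)) (of_real (snd z)) / P (fst z) (snd z))"
    and m: "\<And>k. k < m \<Longrightarrow> p * (real k - (\<Sum>i<M. real (K i j))) + e j \<le> -1"
  shows "vanishes_to_order (\<lambda>x. eval_ps2 c (of_real x) (of_real (a j x))) m"
proof (rule ccontr)
  assume "\<not> ?thesis"
  then obtain k c0 where k: "k < m" "c0 > 0"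
      "\<forall>\<^sub>F x in nhds 0. c0 * \<bar>x\<bar> ^ k \<le> norm (eval_ps2 c (of_real x) (of_real (a j x)))"
    using taylor_dichotomy[OF taylor_upto_eval_ps2[OF c a_taylor[OF j] a_vanishes[OF j]]] by blast
  define f where "f = (\<lambda>z. eval_ps2 c (of_real (fst z)) (of_real (snd z)) / P (fst z) (snd z))"
  obtain U where U: "open U" "(0,0) \<in> U" "set_borel_measurable lborel U f"
      "(\<integral>\<^sup>+z\<in>U. ennreal (norm (f z) powr p) \<partial>lborel) < \<infinity>"
    using Lp unfolding Lp_loc_def f_def by blast
  obtain V W where VW: "open V" "open W" "(0::real) \<in> V" "(0::real) \<in> W" "V \<times> W \<subseteq> U"
    by (rule open_prod_elim[OF U(1,2)]) auto
  obtain \<rho>1 \<rho>2 where \<rho>: "\<rho>1 > 0" "\<And>x. \<bar>x\<bar> < \<rho>1 \<Longrightarrow> x \<in> V" "\<rho>2 > 0" "\<And>x. \<bar>x\<bar> < \<rho>2 \<Longrightarrow> x \<in> W"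
    using VW unfolding open_dist by (force simp: dist_real_def)
  define S where "S = (\<Sum>i<M. real (K i j))"
  obtain c1 d where c1: "c1 > 0" "d > 0" and big: "\<And>x \<theta>. 0 < x \<Longrightarrow> x < d \<Longrightarrow> 0 < \<theta> \<Longrightarrow> \<theta> < 1 \<Longrightarrow>
      \<exists>i\<in>{1..Suc k}. \<bar>a j x + (real i * x ^ e j) * \<theta>\<bar> < \<rho>2 \<and>
        c1 * x powr (real k - S) \<le> norm (f (x, a j x + (real i * x ^ e j) * \<theta>))"
    using quotient_large_near_branch[OF c j \<rho>(3) k(2,3)] unfolding S_def f_def by force
  define g where "g = (\<lambda>z. ennreal (norm (f z) powr p) * indicator U z)"
  have g_eq: "g = (\<lambda>z. ennreal (norm (indicator U z *\<^sub>R f z) powr p) * indicator U z)"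
    by (auto simp: g_def indicator_def fun_eq_iff)
  have g_meas [measurable]: "g \<in> borel_measurable borel"
  proof -
    have [measurable]: "(\<lambda>z. indicator U z *\<^sub>R f z) \<in> borel_measurable borel" "U \<in> sets borel"
      using U(1,3) by (simp_all add: set_borel_measurable_def)
    show ?thesis unfolding g_eq by measurable
  qed
  \<comment> \<open>The bound 1 is what later allows powers of x to be compared through their
    exponents.\<close>
  define h where "h = min 1 (min d \<rho>1)"
  have h: "h > 0" "h \<le> 1" "h \<le> d" "h \<le> \<rho>1" using c1 \<rho> by (auto simp: h_def)
  have slice: "ennreal (c1 powr p / x) * indicator {0<..<h} x \<le> ennreal (real (Suc k)) * (\<integral>\<^sup>+y. g (x, y) \<partial>lborel)" for x
  proof (cases "x \<in> {0<..<h}")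
    case True
    hence x: "0 < x" "x < h" by auto
    define v where "v = c1 powr p * x powr (p * (real k - S))"
    have "ennreal v = (\<integral>\<^sup>+\<theta>. ennreal v * indicator {0<..<1::real} \<theta> \<partial>lborel)"
      by (simp add: nn_integral_cmult_indicator)
    \<comment> \<open>The good node depends on \<open>\<theta>\<close>; summing over all nodes
      avoids a measurable choice of the index.\<close>
    also have "\<dots> \<le> (\<integral>\<^sup>+\<theta>. (\<Sum>i=1..Suc k. g (x, a j x + (real i * x ^ e j) * \<theta>)) \<partial>lborel)"
    proof (rule nn_integral_mono)
      fix \<theta> :: real
      show "ennreal v * indicator {0<..<1} \<theta> \<le> (\<Sum>i=1..Suc k. g (x, a j x + (real i * x ^ e j) * \<theta>))"
      proof (cases "\<theta> \<in> {0<..<1}")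
        case \<theta>: True
        then obtain i where i: "i \<in> {1..Suc k}" "\<bar>a j x + (real i * x ^ e j) * \<theta>\<bar> < \<rho>2"
            "c1 * x powr (real k - S) \<le> norm (f (x, a j x + (real i * x ^ e j) * \<theta>))"
          using big[of x \<theta>] x h by auto
        have "(x, a j x + (real i * x ^ e j) * \<theta>) \<in> U"
          using \<rho>(2)[of x] \<rho>(4)[OF i(2)] x h VW(5) by auto
        moreover have "v \<le> norm (f (x, a j x + (real i * x ^ e j) * \<theta>)) powr p"
        proof -
          have "v = (c1 * x powr (real k - S)) powr p"
            using c1 by (simp add: v_def powr_mult powr_powr mult.commute)
          also have "\<dots> \<le> norm (f (x, a j x + (real i * x ^ e j) * \<theta>)) powr p"
            using i(3) c1 p by (intro powr_mono2) auto
          finally show ?thesis .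
        qed
        ultimately have "ennreal v \<le> g (x, a j x + (real i * x ^ e j) * \<theta>)"
          by (simp add: g_def ennreal_leI)
        also have "\<dots> \<le> (\<Sum>i=1..Suc k. g (x, a j x + (real i * x ^ e j) * \<theta>))"
          using i(1) by (intro member_le_sum) auto
        finally show ?thesis using \<theta> by simp
      qed simp
    qed
    also have "\<dots> = (\<Sum>i=1..Suc k. \<integral>\<^sup>+\<theta>. g (x, a j x + (real i * x ^ e j) * \<theta>) \<partial>lborel)"
      by (rule nn_integral_sum) measurable
    finally have "ennreal (x ^ e j) * ennreal v
        \<le> (\<Sum>i=1..Suc k. ennreal (x ^ e j) * (\<integral>\<^sup>+\<theta>. g (x, a j x + (real i * x ^ e j) * \<theta>) \<partial>lborel))"
      unfolding sum_distrib_left[symmetric] by (intro mult_left_mono) auto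
    also have "\<dots> \<le> (\<Sum>i=1..Suc k. \<integral>\<^sup>+y. g (x, y) \<partial>lborel)"
    proof (rule sum_mono)
      fix i assume i: "i \<in> {1..Suc k}"
      \<comment> \<open>Substituting y = a + i x^e \<theta> produces the Jacobian i x^e, which is at
        least x^e because \<open>i \<ge> 1\<close>.\<close>
      have "(\<integral>\<^sup>+y. g (x, y) \<partial>lborel) = ennreal \<bar>real i * x ^ e j\<bar> * (\<integral>\<^sup>+\<theta>. g (x, a j x + (real i * x ^ e j) * \<theta>) \<partial>lborel)"
        using i x by (intro nn_integral_real_affine) auto
      moreover have "ennreal (x ^ e j) \<le> ennreal \<bar>real i * x ^ e j\<bar>"
        using i x by (intro ennreal_leI) (auto simp: abs_mult mult_le_cancel_right1)
      ultimately show "ennreal (x ^ e j) * (\<integral>\<^sup>+\<theta>. g (x, a j x + (real i * x ^ e j) * \<theta>) \<partial>lborel) \<le> (\<integral>\<^sup>+y. g (x, y) \<partial>lborel)"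
        by (simp add: mult_right_mono)
    qed
    also have "\<dots> = ennreal (real (Suc k)) * (\<integral>\<^sup>+y. g (x, y) \<partial>lborel)"
      by (simp add: ennreal_of_nat_eq_real_of_nat del: of_nat_Suc)
    finally have "ennreal (x ^ e j * v) \<le> ennreal (real (Suc k)) * (\<integral>\<^sup>+y. g (x, y) \<partial>lborel)"
      using x by (simp add: ennreal_mult v_def)
    \<comment> \<open>The exponent \<open>p * (k - S) + e j\<close> is at most -1 and
      \<open>x < 1\<close>, so the slice bound dominates a multiple of 1/x.\<close>
    moreover have "c1 powr p / x \<le> x ^ e j * v"
    proof -
      have "x powr (-1) \<le> x powr (p * (real k - S) + e j)"
        using m[OF k(1)] x h by (intro powr_mono') (auto simp: S_def)
      also have "\<dots> = x ^ e j * x powr (p * (real k - S))"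
        using x by (simp add: powr_add powr_realpow)
      finally have "c1 powr p * x powr (-1) \<le> c1 powr p * (x ^ e j * x powr (p * (real k - S)))"
        by (intro mult_left_mono) auto
      thus ?thesis using x by (simp add: v_def powr_minus_divide mult_ac)
    qed
    hence "ennreal (c1 powr p / x) \<le> ennreal (x ^ e j * v)" by (rule ennreal_leI)
    ultimately show ?thesis using True by simp
  qed simp
  have "\<infinity> = (\<integral>\<^sup>+x\<in>{0<..<h}. ennreal (c1 powr p / x) \<partial>lborel)"
    using nn_integral_inverse_infinite[of "c1 powr p" h] c1 h by simp
  also have "\<dots> \<le> (\<integral>\<^sup>+x. ennreal (real (Suc k)) * (\<integral>\<^sup>+y. g (x, y) \<partial>lborel) \<partial>lborel)"
    by (rule nn_integral_mono) (rule slice)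
  also have "\<dots> = ennreal (real (Suc k)) * (\<integral>\<^sup>+x. \<integral>\<^sup>+y. g (x, y) \<partial>lborel \<partial>lborel)"
    using g_meas by (intro nn_integral_cmult lborel.borel_measurable_nn_integral_fst) (simp add: lborel_prod)
  also have "(\<integral>\<^sup>+x. \<integral>\<^sup>+y. g (x, y) \<partial>lborel \<partial>lborel) = integral\<^sup>N (lborel \<Otimes>\<^sub>M lborel) g"
    using g_meas by (intro lborel.nn_integral_fst) (simp add: lborel_prod)
  also have "\<dots> = (\<integral>\<^sup>+z\<in>U. ennreal (norm (f z) powr p) \<partial>lborel)"
    by (simp add: g_def lborel_prod)
  also have "ennreal (real (Suc k)) * \<dots> < \<infinity>"
    using U(4) by (auto simp: ennreal_mult_less_top simp del: of_nat_Suc)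
  finally show False by simp
qed

end

subsection \<open>Branches of a proper factorization\<close>

text \<open>The cap by \<open>2 * L j\<close> and \<open>2 * L i\<close> makes the value finite even
  when the polynomials agree, so \<open>the_enat\<close> loses nothing.\<close>

lemma Oij_eq_enat: "Oij q L i j = enat (the_enat (Oij q L i j))"
  by (cases "Oij q L i j") (auto simp: Oij_def min_def split: if_splits)

lemma the_enat_Oij_le: "the_enat (Oij q L i j) \<le> 2 * L i" "the_enat (Oij q L i j) \<le> 2 * L j"
proof -
  have "Oij q L i j \<le> enat (2 * L i)" "Oij q L i j \<le> enat (2 * L j)"
    unfolding Oij_def
    by (rule min.coboundedI2, rule min.cobounded2) (rule min.coboundedI2, rule min.cobounded1)
  thus "the_enat (Oij q L i j) \<le> 2 * L i" "the_enat (Oij q L i j) \<le> 2 * L j"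
    by (metis Oij_eq_enat enat_ord_simps(1))+
qed

text \<open>On the diagonal the difference is the zero polynomial, which vanishes to every order, so
  the cap is attained.\<close>

lemma the_enat_Oij_diag: "the_enat (Oij q L j j) = 2 * L j"
proof -
  have "enat (2 * L j) \<le> Ord (\<lambda>x. poly (q j - q j) x)"
  proof -
    have "(\<lambda>x. poly (q j - q j) x) = (\<lambda>x. 0)" by auto
    thus ?thesis by (simp only: enat_le_Ord_iff vanishes_to_order_zero)
  qed
  thus ?thesis by (simp add: Oij_def min_def)
qed

lemma taylor_upto_branch:
  assumes "conv_ps1 (psi j)"
  shows "taylor_upto n (branch q L psi j)"
proof -
  have "taylor_upto n (\<lambda>x. - poly (q j) x - x ^ (2 * L j) * eval_ps1 (psi j) x)"
    using taylor_upto_poly[of n "q j"] taylor_upto_id[of n, where 'a = real] taylor_upto_eval_ps1[OF assms, of n]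
    by (intro taylor_upto_diff taylor_upto_uminus taylor_upto_mult taylor_upto_power) simp_all
  thus ?thesis by (simp add: branch_def[abs_def])
qed

text \<open>The branch differs from \<open>- q j\<close> by no more than the order of the imaginary
  part of the j-th factor of \<open>P\<close>. This is why any such \<open>psi\<close> gives the
  same comparison for \<open>P\<close>.\<close>

lemma vanishes_to_order_branch_offset:
  assumes "conv_ps1 (psi j)"
  shows "vanishes_to_order (\<lambda>x. branch q L psi j x + poly (q j) x) (2 * L j)"
proof -
  have "vanishes_to_order (\<lambda>x. x ^ (2 * L j) * eval_ps1 (psi j) x) (2 * L j + 0)"
    using vanishes_to_order_power_id[of "2 * L j", where 'a = real]
      taylor_upto_vanishes_0[OF taylor_upto_eval_ps1[OF assms]]
    by (intro vanishes_to_order_mult) simp_all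
  hence "vanishes_to_order (\<lambda>x. - (x ^ (2 * L j) * eval_ps1 (psi j) x)) (2 * L j)"
    by (subst vanishes_to_order_uminus) simp
  thus ?thesis by (simp add: branch_def)
qed

lemma vanishes_to_order_1_poly:
  fixes q :: "real poly"
  assumes "poly q 0 = 0"
  shows "vanishes_to_order (poly q) 1"
proof -
  obtain r where r: "q = [:0, 1:] * r" using assms by (auto simp: poly_eq_0_iff_dvd)
  have "vanishes_to_order (\<lambda>x. x ^ 1 * poly r x) (1 + 0)"
    using vanishes_to_order_power_id[of 1, where 'a = real] vanishes_to_order_0_poly[of r]
    by (intro vanishes_to_order_mult) simp_all
  moreover have "poly q = (\<lambda>x. x ^ 1 * poly r x)" by (simp add: r fun_eq_iff)
  ultimately show ?thesis by simp
qed

text \<open>The even power is nonnegative, so \<open>z\<close> has real part \<open>y + u\<close>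
  and imaginary part \<open>\<bar>x\<bar> ^ (2 * l)\<close>. Replacing \<open>- u\<close> by
  \<open>a\<close> moves the real part by at most \<open>C\<close> times the imaginary part; the 2
  in the constant pays for the two parts themselves.\<close>

lemma norm_factor_bounds:
  fixes x y a u C :: real
  assumes "\<bar>a + u\<bar> \<le> C * \<bar>x\<bar> ^ (2 * l)" "C \<ge> 0"
  defines "z \<equiv> complex_of_real y + complex_of_real u + \<i> * complex_of_real x ^ (2 * l)"
  shows "\<bar>y - a\<bar> + \<bar>x\<bar> ^ (2 * l) \<le> (C + 2) * norm z"
    and "norm z \<le> (C + 2) * (\<bar>y - a\<bar> + \<bar>x\<bar> ^ (2 * l))"
proof -
  define X where "X = \<bar>x\<bar> ^ (2 * l)"
  have X: "X \<ge> 0" by (simp add: X_def)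
  have z: "z = Complex (y + u) X"
    by (simp add: z_def X_def complex_eq_iff power_even_abs flip: of_real_power)
  have 1: "\<bar>y + u\<bar> \<le> norm z" "X \<le> norm z"
    using abs_Re_le_cmod[of z] abs_Im_le_cmod[of z] X by (auto simp: z)
  have 2: "norm z \<le> \<bar>y + u\<bar> + X"
    using cmod_le[of z] X by (simp add: z)
  have a: "\<bar>a + u\<bar> \<le> C * X" using assms by (simp add: X_def)
  have CX: "C * X \<le> C * norm z" using 1 assms(2) by (intro mult_left_mono)
  show "\<bar>y - a\<bar> + \<bar>x\<bar> ^ (2 * l) \<le> (C + 2) * norm z"
    using 1 a CX unfolding X_def[symmetric] by (simp add: distrib_right)
  define Y where "Y = \<bar>y - a\<bar>"
  have "\<bar>y + u\<bar> \<le> Y + \<bar>a + u\<bar>" unfolding Y_def by linarith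
  moreover have "0 \<le> C * Y" "0 \<le> Y" using assms(2) by (auto simp: Y_def)
  ultimately show "norm z \<le> (C + 2) * (\<bar>y - a\<bar> + \<bar>x\<bar> ^ (2 * l))"
    using 2 a X unfolding X_def[symmetric] Y_def[symmetric] distrib_left distrib_right by linarith
qed

lemma Pfun_bounds:
  assumes "\<forall>j<M. conv_ps1 (psi j)"
  shows "\<exists>C>0. \<forall>\<^sub>F x in nhds 0. \<forall>y.
    (\<Prod>j<M. \<bar>y - branch q L psi j x\<bar> + \<bar>x\<bar> ^ (2 * L j)) \<le> C * norm (Pfun M q L (of_real x) (of_real y)) \<and>
    norm (Pfun M q L (of_real x) (of_real y)) \<le> C * (\<Prod>j<M. \<bar>y - branch q L psi j x\<bar> + \<bar>x\<bar> ^ (2 * L j))"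
proof -
  have "\<forall>j\<in>{..<M}. \<exists>C. C > 0 \<and> (\<forall>\<^sub>F x in nhds 0. \<bar>branch q L psi j x + poly (q j) x\<bar> \<le> C * \<bar>x\<bar> ^ (2 * L j))"
    using assms vanishes_to_order_branch_offset
    by (fastforce simp: vanishes_to_order_def eventually_nhds_metric dist_real_def)
  from bchoice[OF this] obtain C where C: "\<forall>j\<in>{..<M}. C j > 0"
    "\<forall>j\<in>{..<M}. \<forall>\<^sub>F x in nhds 0. \<bar>branch q L psi j x + poly (q j) x\<bar> \<le> C j * \<bar>x\<bar> ^ (2 * L j)" by blast
  \<comment> \<open>One constant serves both directions because both factor bounds share
    \<open>C j + 2\<close>.\<close>
  define D where "D = (\<Prod>j<M. C j + 2)"
  have D: "D > 0" using C(1) unfolding D_def by (intro prod_pos) force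
  have "\<forall>\<^sub>F x in nhds 0. \<forall>j\<in>{..<M}. \<bar>branch q L psi j x + poly (q j) x\<bar> \<le> C j * \<bar>x\<bar> ^ (2 * L j)"
    using C(2) by (intro eventually_ball_finite) auto
  hence "\<forall>\<^sub>F x in nhds 0. \<forall>y.
    (\<Prod>j<M. \<bar>y - branch q L psi j x\<bar> + \<bar>x\<bar> ^ (2 * L j)) \<le> D * norm (Pfun M q L (of_real x) (of_real y)) \<and>
    norm (Pfun M q L (of_real x) (of_real y)) \<le> D * (\<Prod>j<M. \<bar>y - branch q L psi j x\<bar> + \<bar>x\<bar> ^ (2 * L j))"
  proof (eventually_elim, intro allI)
    fix x y :: real
    assume b: "\<forall>j\<in>{..<M}. \<bar>branch q L psi j x + poly (q j) x\<bar> \<le> C j * \<bar>x\<bar> ^ (2 * L j)"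
    define z where "z = (\<lambda>j. complex_of_real y + complex_of_real (poly (q j) x) + \<i> * complex_of_real x ^ (2 * L j))"
    have P: "norm (Pfun M q L (of_real x) (of_real y)) = (\<Prod>j<M. norm (z j))"
      by (simp add: Pfun_def z_def poly_map_poly_of_real flip: prod_norm)
    have f: "\<bar>y - branch q L psi j x\<bar> + \<bar>x\<bar> ^ (2 * L j) \<le> (C j + 2) * norm (z j)"
      "norm (z j) \<le> (C j + 2) * (\<bar>y - branch q L psi j x\<bar> + \<bar>x\<bar> ^ (2 * L j))" if "j < M" for j
      using norm_factor_bounds[of "branch q L psi j x" "poly (q j) x" "C j" x "L j" y] b C(1) that
      by (auto simp: z_def less_imp_le)
    have "(\<Prod>j<M. \<bar>y - branch q L psi j x\<bar> + \<bar>x\<bar> ^ (2 * L j)) \<le> (\<Prod>j<M. (C j + 2) * norm (z j))"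
      by (intro prod_mono conjI f) auto
    moreover have "(\<Prod>j<M. norm (z j)) \<le> (\<Prod>j<M. (C j + 2) * (\<bar>y - branch q L psi j x\<bar> + \<bar>x\<bar> ^ (2 * L j)))"
      by (intro prod_mono conjI f) auto
    ultimately show "(\<Prod>j<M. \<bar>y - branch q L psi j x\<bar> + \<bar>x\<bar> ^ (2 * L j)) \<le> D * norm (Pfun M q L (of_real x) (of_real y)) \<and>
      norm (Pfun M q L (of_real x) (of_real y)) \<le> D * (\<Prod>j<M. \<bar>y - branch q L psi j x\<bar> + \<bar>x\<bar> ^ (2 * L j))"
      by (simp add: P D_def prod.distrib)
  qed
  with D show ?thesis by blast
qed

lemma branch_system_proper_factorization:
  assumes L_pos: "\<forall>j<M. L j \<ge> 1"
    and q0: "\<forall>j<M. poly (q j) 0 = 0"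
    and prop_t: "proper_factorization M q L t cu psi"
  shows "branch_system M (\<lambda>j. 2 * L j) (\<lambda>i j. the_enat (Oij q L i j)) (branch q L psi)
    (\<lambda>x y. Pfun M q L (of_real x) (of_real y))"
proof
  have psi: "\<forall>j<M. conv_ps1 (psi j)" using prop_t by (simp add: proper_factorization_def)
  fix j assume j: "j < M"
  show "1 \<le> 2 * L j" using L_pos j by fastforce
  show "the_enat (Oij q L j j) = 2 * L j" by (rule the_enat_Oij_diag)
  show "taylor_upto n (branch q L psi j)" for n using psi j by (intro taylor_upto_branch) auto
  have "vanishes_to_order (\<lambda>x. branch q L psi j x + poly (q j) x) 1"
    using vanishes_to_order_mono[OF vanishes_to_order_branch_offset, of psi j 1 L q] psi j L_pos by fastforce
  from vanishes_to_order_diff[OF this vanishes_to_order_1_poly[of "q j"]] q0 j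
  show "vanishes_to_order (branch q L psi j) 1" by simp
next
  fix i j assume ij: "i < M" "j < M"
  show "the_enat (Oij q L i j) \<le> 2 * L i" "the_enat (Oij q L i j) \<le> 2 * L j"
    by (rule the_enat_Oij_le)+
  assume "i \<noteq> j"
  define f where "f = (\<lambda>x. branch q L psi j x - branch q L psi i x)"
  have psi: "conv_ps1 (psi i)" "conv_ps1 (psi j)"
    using prop_t ij by (simp_all add: proper_factorization_def)
  have f: "taylor_upto n f" for n
    unfolding f_def using psi by (intro taylor_upto_diff taylor_upto_branch)
  \<comment> \<open>Branches carry a minus sign relative to the factors, so their difference is the
    negative of the function in the order condition.\<close>
  have "Ord f = Ord (\<lambda>x. - f x)"
    by (simp add: Ord_def vanishes_to_order_uminus)
  also have "(\<lambda>x. - f x) = (\<lambda>x. poly (q j - q i) x + x ^ (2 * L j) * eval_ps1 (psi j) x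
                  - x ^ (2 * L i) * eval_ps1 (psi i) x)"
    by (auto simp: f_def branch_def)
  also have "Ord \<dots> = Oij q L i j"
    using prop_t ij \<open>i \<noteq> j\<close> by (simp add: proper_factorization_def)
  finally have Ord: "Ord f = enat (the_enat (Oij q L i j))"
    using Oij_eq_enat[of q L i j] by simp
  show "vanishes_to_order (\<lambda>x. branch q L psi j x - branch q L psi i x) (the_enat (Oij q L i j))"
    using enat_le_Ord_iff[OF taylor_upto_vanishes_0[OF f], of "the_enat (Oij q L i j)"] Ord
    by (simp add: f_def)
  show "\<exists>c>0. \<forall>\<^sub>F x in nhds 0. c * \<bar>x\<bar> ^ the_enat (Oij q L i j) \<le> \<bar>branch q L psi j x - branch q L psi i x\<bar>"
    using Ord_eq_enat_imp_lower_bound[OF f Ord] by (simp add: f_def)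
next
  obtain C where C: "C > 0" "\<forall>\<^sub>F x in nhds 0. \<forall>y.
    (\<Prod>j<M. \<bar>y - branch q L psi j x\<bar> + \<bar>x\<bar> ^ (2 * L j)) \<le> C * norm (Pfun M q L (of_real x) (of_real y)) \<and>
    norm (Pfun M q L (of_real x) (of_real y)) \<le> C * (\<Prod>j<M. \<bar>y - branch q L psi j x\<bar> + \<bar>x\<bar> ^ (2 * L j))"
    using Pfun_bounds[of M psi q L] prop_t by (auto simp: proper_factorization_def)
  show "\<exists>c>0. \<forall>\<^sub>F x in nhds 0. \<forall>y. c * (\<Prod>j<M. \<bar>y - branch q L psi j x\<bar> + \<bar>x\<bar> ^ (2 * L j))
      \<le> norm (Pfun M q L (of_real x) (of_real y))"
    using C by (intro exI[of _ "1 / C"]) (auto elim!: eventually_mono simp: divide_simps mult.commute)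
  show "\<exists>C>0. \<forall>\<^sub>F x in nhds 0. \<forall>y. norm (Pfun M q L (of_real x) (of_real y))
      \<le> C * (\<Prod>j<M. \<bar>y - branch q L psi j x\<bar> + \<bar>x\<bar> ^ (2 * L j))"
    using C by (intro exI[of _ C]) (auto elim!: eventually_mono)
  show "(\<lambda>z. Pfun M q L (of_real (fst z)) (of_real (snd z))) \<in> borel_measurable borel"
    unfolding Pfun_def by (intro borel_measurable_continuous_onI continuous_intros)
qed

section \<open>The criterion for the original polynomial\<close>

theorem theorem5p2:
  fixes M :: nat and L :: "nat \<Rightarrow> nat" and q :: "nat \<Rightarrow> real poly"
    and t :: real and cu :: "nat \<Rightarrow> nat \<Rightarrow> complex" and psi :: "nat \<Rightarrow> nat \<Rightarrow> real"
    and p :: real and cQ :: "nat \<Rightarrow> nat \<Rightarrow> complex"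
  assumes L_pos: "\<forall>j<M. L j \<ge> 1"
    and deg_q: "\<forall>j<M. degree (q j) < 2 * L j"
    and q0: "\<forall>j<M. poly (q j) 0 = 0"
    and prop_t: "proper_factorization M q L t cu psi"
    and p: "1 \<le> p"
    and Q: "conv_ps2 cQ"
  shows "Lp_loc p (\<lambda>z. eval_ps2 cQ (of_real (fst z)) (of_real (snd z))
                        / Pfun M q L (of_real (fst z)) (of_real (snd z)))
     \<longleftrightarrow> (\<forall>j<M. enat (nat ((\<Sum>i<M. int (the_enat (Oij q L i j)))
                               - \<lceil>real (2 * L j + 1) / p\<rceil> + 1))
                 \<le> Ord (\<lambda>x. eval_ps2 cQ (of_real x) (of_real (branch q L psi j x))))"
proof -
  define K where "K = (\<lambda>i j. the_enat (Oij q L i j))"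
  interpret branch_system M "\<lambda>j. 2 * L j" K "branch q L psi"
      "\<lambda>x y. Pfun M q L (of_real x) (of_real y)"
    unfolding K_def using L_pos q0 prop_t by (rule branch_system_proper_factorization)
  define S where "S = (\<lambda>j. \<Sum>i<M. int (K i j))"
  \<comment> \<open>A negative bound is truncated to 0, where the order condition holds trivially.
    The next two facts show that \<open>m j\<close> is the least natural number whose exponent
    \<open>p * (m j - S j) + 2 * L j\<close> exceeds -1.\<close>
  define m where "m = (\<lambda>j. nat (S j - \<lceil>real (2 * L j + 1) / p\<rceil> + 1))"
  have S: "(\<Sum>i<M. real (K i j)) = of_int (S j)" for j by (simp add: S_def)
  have Ord_iff: "enat (m j) \<le> Ord (\<lambda>x. eval_ps2 cQ (of_real x) (of_real (branch q L psi j x)))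
      \<longleftrightarrow> vanishes_to_order (\<lambda>x. eval_ps2 cQ (of_real x) (of_real (branch q L psi j x))) (m j)" if "j < M" for j
    using taylor_upto_vanishes_0[OF taylor_upto_eval_ps2[OF Q a_taylor[OF that] a_vanishes[OF that]]]
    by (rule enat_le_Ord_iff)
  \<comment> \<open>Truncation can only increase \<open>m j\<close>, and a ceiling exceeds its
    argument by less than 1.\<close>
  have above: "p * (real (m j) - of_int (S j)) + real (2 * L j) > -1" for j
  proof -
    have "real (m j) - of_int (S j) \<ge> 1 - of_int \<lceil>real (2 * L j + 1) / p\<rceil>"
      unfolding m_def by linarith
    moreover have "of_int \<lceil>real (2 * L j + 1) / p\<rceil> < real (2 * L j + 1) / p + 1" by linarith
    ultimately have "real (m j) - of_int (S j) > - (real (2 * L j + 1) / p)" by linarith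
    hence "p * (real (m j) - of_int (S j)) > p * - (real (2 * L j + 1) / p)"
      using p by (intro mult_strict_left_mono) auto
    thus ?thesis using p by simp
  qed
  \<comment> \<open>A natural number \<open>k\<close> below \<open>m j\<close> forces the
    untruncated bound to be positive, so \<open>nat\<close> changes nothing here.\<close>
  have below: "p * (real k - of_int (S j)) + real (2 * L j) \<le> -1" if "k < m j" for j k
  proof -
    have "int k \<le> S j - \<lceil>real (2 * L j + 1) / p\<rceil>" using that unfolding m_def by linarith
    hence "real k - of_int (S j) \<le> - of_int \<lceil>real (2 * L j + 1) / p\<rceil>" by linarith
    also have "\<dots> \<le> - (real (2 * L j + 1) / p)" by linarith
    finally have "p * (real k - of_int (S j)) \<le> p * - (real (2 * L j + 1) / p)"
      using p by (intro mult_left_mono) auto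
    thus ?thesis using p by simp
  qed
  have "Lp_loc p (\<lambda>z. eval_ps2 cQ (of_real (fst z)) (of_real (snd z))
          / Pfun M q L (of_real (fst z)) (of_real (snd z)))
      \<longleftrightarrow> (\<forall>j<M. enat (m j) \<le> Ord (\<lambda>x. eval_ps2 cQ (of_real x) (of_real (branch q L psi j x))))"
    using Lp_loc_quotient_if_vanishes[OF Q p, of m] vanishes_if_Lp_loc_quotient[OF Q p]
      above below Ord_iff unfolding S by blast
  thus ?thesis by (simp only: m_def S_def K_def)
qed

end
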